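(* In the diffusion setting described in the context, for every $0<c<1$, the pseudometric $\overline{d}^c$ is a fixpoint of $\mathcal{G}_c$, i.e. $\mathcal{G}_c(\overline{d}^c)(x,y)=\overline{d}^c(x,y)$ for all $x,y\in E$.
   Context: Setting (diffusion). Let $E$ be a locally compact Hausdorff space with a countable base, with its Borel $\sigma$-algebra; $E$ is Polish and $\Delta$ is a fixed 1-bounded metric generating its topology $\mathcal{O}$. Let $(\hat P_t)_{t\ge 0}$ be an honest Feller–Dynkin semigroup on $C_0(E)$ with associated Markov (probability) kernels $P_t(x,\cdot)$. It is assumed to be a diffusion: the trajectory space is $\Omega=\{\omega:[0,\infty)\to E \text{ continuous}\}$ with the $\sigma$-algebra generated by evaluations and the topology generated by the uniform metric $U(\Delta)(\omega,\omega')=\sup_{t\ge0}\Delta(\omega(t),\omega'(t))$ (treated as Polish); for each $x\in E$, $\mathbb{P}^x$ is the law on $\Omega$ of the process started at $x$ (finite-dimensional distributions $\delta_x(\mathrm{d}x_0)P_{t_1}(x_0,\mathrm{d}x_1)\cdots P_{t_n-t_{n-1}}(x_{n-1},\mathrm{d}x_n)$); and $x\mapsto\mathbb{P}^x$ is weakly continuous. A continuous observable $obs:E\to[0,1]$ is given. Optimal transport: for Polish $\mathcal X$, lower semi-continuous $c:\mathcal X\times\mathcal X\to[0,1]$ with $c(x,x)=0$, and probability measures $\mu,\nu$, $W(c)(\mu,\nu)=\min_{\gamma\in\Gamma(\mu,\nu)}\int c\,\mathrm{d}\gamma$ over couplings $\Gamma(\mu,\nu)$. For a 1-bounded lower semi-continuous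 pseudometric $m$ on $E$: $U_c(m)(\omega,\omega')=\sup_{t\ge0}c^tm(\omega(t),\omega'(t))$ and $\mathcal{G}_c(m)(x,y)=W(U_c(m))(\mathbb{P}^x,\mathbb{P}^y)$. Define $d^c_0(x,y)=|obs(x)-obs(y)|$, $d^c_{n+1}=\mathcal{G}_c(d^c_n)$ for $n\ge0$ (each $d^c_n$ is a continuous pseudometric, so this is well defined), and $\overline{d}^c=\sup_{n}d^c_n$ (a lower semi-continuous pseudometric). *)

theory Defs
  imports "HOL-Probability.Probability"
begin

section \<open>Feller-Dynkin semigroups\<close>

definition C0 :: "('a::topological_space \<Rightarrow> real) set" where
  "C0 = {f. continuous_on UNIV f \<and> (\<forall>\<epsilon>>0. \<exists>K. compact K \<and> (\<forall>x. x \<notin> K \<longrightarrow> \<bar>f x\<bar> < \<epsilon>))}"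

locale feller_dynkin_semigroup =
  fixes Phat :: "real \<Rightarrow> ('a::topological_space \<Rightarrow> real) \<Rightarrow> ('a \<Rightarrow> real)"
  assumes maps_C0: "\<And>t f. 0 \<le> t \<Longrightarrow> f \<in> C0 \<Longrightarrow> Phat t f \<in> C0"
    and linear_add: "\<And>t f g. 0 \<le> t \<Longrightarrow> f \<in> C0 \<Longrightarrow> g \<in> C0 \<Longrightarrow>
      Phat t (\<lambda>x. f x + g x) = (\<lambda>x. Phat t f x + Phat t g x)"
    and linear_scale: "\<And>t f a. 0 \<le> t \<Longrightarrow> f \<in> C0 \<Longrightarrow>
      Phat t (\<lambda>x. a * f x) = (\<lambda>x. a * Phat t f x)"
    and sub_markov: "\<And>t f. 0 \<le> t \<Longrightarrow> f \<in> C0 \<Longrightarrow> (\<forall>x. 0 \<le> f x \<and> f x \<le> 1) \<Longrightarrow>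
      (\<forall>x. 0 \<le> Phat t f x \<and> Phat t f x \<le> 1)"
    and semigroup: "\<And>s t f. 0 \<le> s \<Longrightarrow> 0 \<le> t \<Longrightarrow> f \<in> C0 \<Longrightarrow> Phat (s + t) f = Phat s (Phat t f)"
    and identity: "\<And>f. f \<in> C0 \<Longrightarrow> Phat 0 f = f"
    and strongly_continuous: "\<And>f. f \<in> C0 \<Longrightarrow> uniform_limit UNIV (\<lambda>t. Phat t f) f (at_right 0)"

text \<open>Honesty: the kernels representing the semigroup are Markov, not merely sub-Markov.\<close>

locale honest_feller_dynkin = feller_dynkin_semigroup Phat
  for Phat :: "real \<Rightarrow> ('a::topological_space \<Rightarrow> real) \<Rightarrow> ('a \<Rightarrow> real)" +
  fixes P :: "real \<Rightarrow> 'a \<Rightarrow> 'a measure"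
  assumes markov_kernel: "\<And>t. 0 \<le> t \<Longrightarrow> P t \<in> borel \<rightarrow>\<^sub>M prob_algebra borel"
    and kernel_represents: "\<And>t f x. 0 \<le> t \<Longrightarrow> f \<in> C0 \<Longrightarrow> Phat t f x = (\<integral>y. f y \<partial>P t x)"


section \<open>Trajectories\<close>

text \<open>A trajectory is a function on \<^term>\<open>{0..} :: real set\<close>, encoded as an extensional function.\<close>

definition trajectories :: "(real \<Rightarrow> 'a::topological_space) set" where
  "trajectories = {\<omega> \<in> extensional {0..}. continuous_on {0..} \<omega>}"

text \<open>The \<open>\<sigma>\<close>-algebra generated by the evaluations.\<close>

definition trajectory_space :: "(real \<Rightarrow> 'a::topological_space) measure" where
  "trajectory_space = restrict_space (\<Pi>\<^sub>M t\<in>{0..}. borel) trajectories"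

definition uniform_dist :: "('a \<Rightarrow> 'a \<Rightarrow> real) \<Rightarrow> (real \<Rightarrow> 'a) \<Rightarrow> (real \<Rightarrow> 'a) \<Rightarrow> real" where
  "uniform_dist \<Delta> \<omega> \<omega>' = (SUP t\<in>{0..}. \<Delta> (\<omega> t) (\<omega>' t))"

definition uniform_topology ::
    "('a::topological_space \<Rightarrow> 'a \<Rightarrow> real) \<Rightarrow> (real \<Rightarrow> 'a) topology" where
  "uniform_topology \<Delta> = Metric_space.mtopology trajectories (uniform_dist \<Delta>)"

lemma space_trajectory_space: "space trajectory_space = trajectories"
  by (auto simp: trajectory_space_def space_restrict_space space_PiM trajectories_def PiE_def)

lemma Metric_space_uniform_dist:
  fixes \<Delta> :: "'a::topological_space \<Rightarrow> 'a \<Rightarrow> real"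
  assumes "Metric_space UNIV \<Delta>" and bounded: "\<And>x y. \<Delta> x y \<le> 1"
  shows "Metric_space trajectories (uniform_dist \<Delta>)"
proof -
  interpret \<Delta>: Metric_space UNIV \<Delta> by fact
  have bdd: "bdd_above ((\<lambda>t. \<Delta> (\<omega> t) (\<omega>' t)) ` {0..})" for \<omega> \<omega>' :: "real \<Rightarrow> 'a"
    using bounded by (intro bdd_aboveI[of _ 1]) auto
  have upper: "\<Delta> (\<omega> t) (\<omega>' t) \<le> uniform_dist \<Delta> \<omega> \<omega>'" if "0 \<le> t" for t and \<omega> \<omega>' :: "real \<Rightarrow> 'a"
    unfolding uniform_dist_def using that bdd by (intro cSUP_upper) auto
  have nonneg: "0 \<le> uniform_dist \<Delta> \<omega> \<omega>'" for \<omega> \<omega>' :: "real \<Rightarrow> 'a"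
    using upper[of 0 \<omega> \<omega>'] \<Delta>.nonneg order_trans by blast
  show ?thesis
  proof
    show "uniform_dist \<Delta> x y = uniform_dist \<Delta> y x" for x y
      by (simp add: uniform_dist_def \<Delta>.commute)
  next
    fix x y :: "real \<Rightarrow> 'a" assume xy: "x \<in> trajectories" "y \<in> trajectories"
    show "uniform_dist \<Delta> x y = 0 \<longleftrightarrow> x = y"
    proof
      assume "uniform_dist \<Delta> x y = 0"
      then have "\<Delta> (x t) (y t) = 0" if "0 \<le> t" for t
        using upper[OF that, of x y] \<Delta>.nonneg[of "x t" "y t"] by linarith
      then show "x = y"
        using xy by (intro extensionalityI[of x "{0..}" y]) (auto simp: trajectories_def)
    next
      assume "x = y" then show "uniform_dist \<Delta> x y = 0"
        by (simp add: uniform_dist_def)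
    qed
  next
    fix x y z :: "real \<Rightarrow> 'a"
    show "uniform_dist \<Delta> x z \<le> uniform_dist \<Delta> x y + uniform_dist \<Delta> y z"
      unfolding uniform_dist_def[of \<Delta> x z]
    proof (rule cSUP_least)
      fix t :: real assume "t \<in> {0..}"
      then show "\<Delta> (x t) (z t) \<le> uniform_dist \<Delta> x y + uniform_dist \<Delta> y z"
        using upper[of t x y] upper[of t y z] \<Delta>.triangle[of "x t" "y t" "z t"] by auto
    qed auto
  qed (rule nonneg)
qed


section \<open>Diffusions\<close>

text \<open>
  For times \<open>s < t\<^sub>1 < \<dots> < t\<^sub>n\<close> and Borel sets \<open>B\<^sub>1, \<dots>, B\<^sub>n\<close>, this is the iterated integral
  \<open>\<integral>\<^bsub>B\<^sub>1\<^esub> P (t\<^sub>1 - s) x dx\<^sub>1 \<dots> \<integral>\<^bsub>B\<^sub>n\<^esub> P (t\<^sub>n - t\<^sub>n\<^sub>-\<^sub>1) x\<^sub>n\<^sub>-\<^sub>1 dx\<^sub>n\<close>.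
\<close>

primrec cylinder_prob ::
    "(real \<Rightarrow> 'a \<Rightarrow> 'a measure) \<Rightarrow> real \<Rightarrow> 'a \<Rightarrow> (real \<times> 'a set) list \<Rightarrow> ennreal" where
  "cylinder_prob P s x [] = 1"
| "cylinder_prob P s x (tB # tBs) =
     (\<integral>\<^sup>+ y. indicator (snd tB) y * cylinder_prob P (fst tB) y tBs \<partial>P (fst tB - s) x)"

text \<open>
  The uniform topology on trajectories is in general not separable, and its Borel sets need not be
  generated by the evaluations; weak continuity of the laws is therefore tested on those bounded
  functions, continuous for the uniform metric, whose integral makes sense, i.e. the measurable ones
  (on a Polish trajectory space, where both \<open>\<sigma>\<close>-algebras agree, this is no restriction).
  The metric carried by the class \<^class>\<open>polish_space\<close> plays no role; only its topology is used.
\<close>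

locale diffusion = honest_feller_dynkin Phat P
  for Phat :: "real \<Rightarrow> ('a::polish_space \<Rightarrow> real) \<Rightarrow> ('a \<Rightarrow> real)"
    and P :: "real \<Rightarrow> 'a \<Rightarrow> 'a measure" +
  fixes \<Delta> :: "'a \<Rightarrow> 'a \<Rightarrow> real"
    and \<P> :: "'a \<Rightarrow> (real \<Rightarrow> 'a) measure"
  assumes locally_compact: "locally_compact_space (euclidean :: 'a topology)"
    and metric: "Metric_space UNIV \<Delta>"
    and metric_topology: "Metric_space.mtopology UNIV \<Delta> = euclidean"
    and metric_bounded: "\<And>x y. \<Delta> x y \<le> 1"
    and law: "\<And>x. \<P> x \<in> space (prob_algebra trajectory_space)"
    and finite_dim_distributions: "\<And>x A tBs. A \<in> sets borel \<Longrightarrow>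
      sorted_wrt (<) (0 # map fst tBs) \<Longrightarrow> (\<forall>(t, B) \<in> set tBs. B \<in> sets borel) \<Longrightarrow>
      emeasure (\<P> x) {\<omega> \<in> trajectories. \<omega> 0 \<in> A \<and> (\<forall>(t, B) \<in> set tBs. \<omega> t \<in> B)} =
        indicator A x * cylinder_prob P 0 x tBs"
    and weakly_continuous: "\<And>F :: (real \<Rightarrow> 'a) \<Rightarrow> real.
      continuous_map (uniform_topology \<Delta>) euclidean F \<Longrightarrow>
      bounded (F ` trajectories) \<Longrightarrow> F \<in> borel_measurable trajectory_space \<Longrightarrow>
      continuous_on UNIV (\<lambda>x. \<integral>\<omega>. F \<omega> \<partial>\<P> x)"


section \<open>Optimal transport and the functional\<close>

definition couplings :: "'b measure \<Rightarrow> 'c measure \<Rightarrow> ('b \<times> 'c) measure set" where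
  "couplings \<mu> \<nu> = {\<gamma>. sets \<gamma> = sets (\<mu> \<Otimes>\<^sub>M \<nu>) \<and> distr \<gamma> \<mu> fst = \<mu> \<and> distr \<gamma> \<nu> snd = \<nu>}"

definition transport_cost :: "('b \<Rightarrow> 'b \<Rightarrow> real) \<Rightarrow> 'b measure \<Rightarrow> 'b measure \<Rightarrow> real" where
  "transport_cost k \<mu> \<nu> = (INF \<gamma>\<in>couplings \<mu> \<nu>. \<integral>z. k (fst z) (snd z) \<partial>\<gamma>)"

definition discounted_sup ::
    "real \<Rightarrow> ('a \<Rightarrow> 'a \<Rightarrow> real) \<Rightarrow> (real \<Rightarrow> 'a) \<Rightarrow> (real \<Rightarrow> 'a) \<Rightarrow> real" where
  "discounted_sup c m \<omega> \<omega>' = (SUP t\<in>{0..}. c powr t * m (\<omega> t) (\<omega>' t))"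

definition \<G> ::
    "('a \<Rightarrow> (real \<Rightarrow> 'a) measure) \<Rightarrow> real \<Rightarrow> ('a \<Rightarrow> 'a \<Rightarrow> real) \<Rightarrow> 'a \<Rightarrow> 'a \<Rightarrow> real" where
  "\<G> \<P> c m x y = transport_cost (discounted_sup c m) (\<P> x) (\<P> y)"

primrec iterated_dist ::
    "('a \<Rightarrow> (real \<Rightarrow> 'a) measure) \<Rightarrow> ('a \<Rightarrow> real) \<Rightarrow> real \<Rightarrow> nat \<Rightarrow> 'a \<Rightarrow> 'a \<Rightarrow> real" where
  "iterated_dist \<P> obs c 0 = (\<lambda>x y. \<bar>obs x - obs y\<bar>)"
| "iterated_dist \<P> obs c (Suc n) = \<G> \<P> c (iterated_dist \<P> obs c n)"

definition limit_dist ::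
    "('a \<Rightarrow> (real \<Rightarrow> 'a) measure) \<Rightarrow> ('a \<Rightarrow> real) \<Rightarrow> real \<Rightarrow> 'a \<Rightarrow> 'a \<Rightarrow> real" where
  "limit_dist \<P> obs c x y = (SUP n. iterated_dist \<P> obs c n x y)"

end

theory Submission
  imports Defs
begin

text \<open>
  Since \<open>\<G> m \<ge> m\<close>, only \<open>\<G>\<close> of the limit being at most the limit needs work. Take nearly optimal couplings
  \<open>\<gamma>\<^sub>n\<close> for the costs built from the iterates \<open>d\<^sub>n\<close> and pass to a limit coupling \<open>\<gamma>\<close>. Each cost is lower
  semicontinuous, so for fixed \<open>k\<close> the cost of \<open>d\<^sub>k\<close> under \<open>\<gamma>\<close> is bounded by the limit distance, and
  dominated convergence in \<open>k\<close> concludes. The same limit argument, applied along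
  converging starting points, shows that \<open>\<G>\<close> preserves lower semicontinuity; continuity of the
  iterates (hence the triangle inequality for \<open>\<G>\<close> and the gluing of couplings) is never needed.

  The uniform topology on trajectories is not separable, so compactness is obtained elsewhere:
  a continuous trajectory is determined by its values at rational times, the cost is a
  supremum over rational times, and the space of all functions on the rationals with the product
  topology is Polish. The limit of couplings there is first taken setwise, along a filter provided
  by Tychonoff's theorem; this gives a finitely additive function, and tightness of the marginals
  makes it countably additive on an algebra generating the Borel sets.
\<close>

section \<open>Limits of couplings on Polish spaces\<close>

text \<open>The law of \<open>h\<close> has at most countably many atoms, while the interval is
  uncountable. This supplies sets with null boundary as level sets of distance functions.\<close>

lemma exists_level_null:
  fixes h :: "'a \<Rightarrow> real"
  assumes "finite_measure M" and [measurable]: "h \<in> borel_measurable M" and "a < b"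
  shows "\<exists>\<delta>. a < \<delta> \<and> \<delta> < b \<and> measure M {x \<in> space M. h x = \<delta>} = 0"
proof -
  interpret finite_measure M by fact
  interpret N: finite_measure "distr M borel h"
    by (rule finite_measure_distr) simp
  obtain \<delta> where \<delta>: "\<delta> \<in> {a<..<b} - {x. measure (distr M borel h) {x} \<noteq> 0}"
    using open_minus_countable[OF N.countable_support, of "{a<..<b}"] \<open>a < b\<close> by auto
  have "measure M {x \<in> space M. h x = \<delta>} = measure (distr M borel h) {\<delta>}"
    by (subst measure_distr) (auto intro!: arg_cong[where f="measure M"])
  then show ?thesis using \<delta> by auto
qed

text \<open>The sets where the distance \<open>h\<close> to the complement of \<open>U\<close>
  exceeds a level increase to \<open>U\<close> as the level decreases to 0. The boundary of such a
  set lies in a level set of \<open>h\<close>, and all but countably many levels are null.\<close>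

lemma open_inner_continuity_set:
  fixes U :: "'a::metric_space set"
  assumes "finite_measure M" and M[measurable_cong]: "sets M = sets borel" and U: "open U" and "0 < \<epsilon>"
  shows "\<exists>A. open A \<and> closure A \<subseteq> U \<and> measure M (frontier A) = 0 \<and> measure M (U - A) < \<epsilon>"
\<comment> \<open>The complement is empty here, and \<open>infdist\<close> to the empty set is 0 by
  convention, so \<open>h\<close> would not be positive on \<open>U\<close>.\<close>
proof (cases "U = UNIV")
  case True
  then show ?thesis using \<open>0 < \<epsilon>\<close> by (intro exI[of _ UNIV]) auto
next
  case False
  interpret finite_measure M by fact
  define h where "h x = infdist x (- U)" for x
  have h[continuous_intros]: "continuous_on S h" for S
    unfolding h_def by (intro continuous_intros)
  then have [measurable]: "h \<in> borel_measurable M"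
    using borel_measurable_continuous_onI[of h] M by (auto cong: measurable_cong_sets)
  have spM: "space M = UNIV" using M by (metis sets_eq_imp_space_eq space_borel)
  have meas: "closed C \<Longrightarrow> C \<in> sets M" "open C \<Longrightarrow> C \<in> sets M" for C using M by auto
  have pos: "0 < h x \<longleftrightarrow> x \<in> U" for x
    using False U in_closed_iff_infdist_zero[of "- U" x] infdist_nonneg[of x "-U"]
    unfolding h_def by (auto simp: closed_def less_le)
  have op: "open {x. h x > a}" for a
    by (intro open_Collect_less continuous_intros)
  have "(\<lambda>n. measure M {x. h x > 1 / Suc n}) \<longlonglongrightarrow> measure M (\<Union>n. {x. h x > 1 / Suc n})"
  proof (rule finite_Lim_measure_incseq)
    show "incseq (\<lambda>n. {x. h x > 1 / Suc n})"
      by (auto simp: incseq_def intro: order.strict_trans1[rotated] simp: frac_le)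
  qed (use op meas in auto)
  moreover have "(\<Union>n. {x. h x > 1 / Suc n}) = U"
  proof -
    have "0 < h x \<longleftrightarrow> (\<exists>n. h x > 1 / Suc n)" for x
    proof
      assume "0 < h x" then show "\<exists>n. h x > 1 / Suc n"
        using reals_Archimedean[of "h x"] by (auto simp: inverse_eq_divide)
    next
      assume "\<exists>n. h x > 1 / Suc n"
      then show "0 < h x"
        by (meson divide_pos_pos of_nat_0_less_iff order.strict_trans zero_less_Suc zero_less_one)
    qed
    then show ?thesis using pos by auto
  qed
  ultimately have "(\<lambda>n. measure M {x. h x > 1 / Suc n}) \<longlonglongrightarrow> measure M U" by simp
  then have "\<forall>\<^sub>F n in sequentially. measure M {x. h x > 1 / Suc n} > measure M U - \<epsilon>"
    by (rule order_tendstoD) (use \<open>0 < \<epsilon>\<close> in auto)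
  then obtain n where n: "measure M {x. h x > 1 / Suc n} > measure M U - \<epsilon>"
    by (auto dest: eventually_happens)
  obtain \<delta> where \<delta>: "0 < \<delta>" "\<delta> < 1 / Suc n" "measure M {x. h x = \<delta>} = 0"
    using exists_level_null[OF assms(1), of h 0 "1 / Suc n"] spM by auto
  define A where "A = {x. h x > \<delta>}"
  have cl: "closure A \<subseteq> {x. h x \<ge> \<delta>}"
    by (rule closure_minimal) (auto simp: A_def intro!: closed_Collect_le continuous_intros)
  have A: "open A" "A \<subseteq> U"
    using op pos[THEN iffD1] order.strict_trans[OF \<delta>(1)] by (auto simp: A_def)
  have "measure M (frontier A) \<le> measure M {x. h x = \<delta>}"
  proof (rule finite_measure_mono)
    show "frontier A \<subseteq> {x. h x = \<delta>}"
      using cl A by (auto simp: frontier_def interior_open A_def)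
    show "{x. h x = \<delta>} \<in> sets M" by (intro meas closed_Collect_eq continuous_intros)
  qed
  moreover have "measure M (U - A) = measure M U - measure M A"
    using A U meas by (intro finite_measure_Diff) auto
  moreover have "measure M {x. h x > 1 / Suc n} \<le> measure M A"
    using A \<delta> meas by (intro finite_measure_mono) (auto simp: A_def)
  ultimately have "measure M (frontier A) = 0" "measure M (U - A) < \<epsilon>"
    using \<delta>(3) n measure_nonneg[of M "frontier A"] by linarith+
  moreover have "closure A \<subseteq> U"
    using cl pos[THEN iffD1] order.strict_trans2[OF \<delta>(1)] by blast
  ultimately show ?thesis using A by blast
qed

text \<open>The closed-set half of the portmanteau theorem, for an arbitrary filter. A continuous
  bump \<open>f\<close> lies between the indicator of \<open>C\<close> and that of a thin
  neighbourhood of \<open>C\<close>, whose mass under \<open>N\<close> is close to that of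
  \<open>C\<close> because such neighbourhoods decrease to \<open>C\<close>.\<close>

lemma weak_limit_closed:
  fixes C :: "'a::metric_space set"
  assumes prob: "\<And>i. prob_space (M i)" "\<And>i. sets (M i) = sets borel"
    and N: "prob_space N" "sets N = sets borel"
    and lim: "\<And>f :: 'a \<Rightarrow> real. continuous_on UNIV f \<Longrightarrow> bounded (range f) \<Longrightarrow>
       ((\<lambda>i. \<integral>x. f x \<partial>M i) \<longlongrightarrow> (\<integral>x. f x \<partial>N)) F"
    and C: "closed C" and "0 < \<epsilon>"
  shows "\<forall>\<^sub>F i in F. measure (M i) C < measure N C + \<epsilon>"
proof (cases "C = {}")
  case True
  then show ?thesis using \<open>0 < \<epsilon>\<close> by simp
next
  case False
  interpret N: prob_space N by fact
  define h where "h x = infdist x C" for x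
  have h[continuous_intros]: "continuous_on S h" for S
    unfolding h_def by (intro continuous_intros)
  have h0: "0 \<le> h x" "h x = 0 \<longleftrightarrow> x \<in> C" for x
    using C False in_closed_iff_infdist_zero[of C x] by (auto simp: h_def infdist_nonneg)
  have op: "open {x. h x < a}" for a
    by (intro open_Collect_less continuous_intros)
  have "(\<lambda>n. measure N {x. h x < 1 / Suc n}) \<longlonglongrightarrow> measure N (\<Inter>n. {x. h x < 1 / Suc n})"
  proof (rule N.finite_Lim_measure_decseq)
    show "decseq (\<lambda>n. {x. h x < 1 / Suc n})"
      by (auto simp: decseq_def) (smt (verit) frac_le of_nat_mono of_nat_0_le_iff)
  qed (use op N in auto)
  moreover have "(\<Inter>n. {x. h x < 1 / Suc n}) = C"
  proof -
    have "x \<in> C" if "\<And>n. h x < 1 / Suc n" for x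
    proof (rule ccontr)
      assume "x \<notin> C" then have "0 < h x" using h0[of x] by auto
      then show False
        using reals_Archimedean[of "h x"] that by (force simp: inverse_eq_divide dest: less_asym)
    qed
    then show ?thesis by (auto simp: h0(2)[THEN iffD2])
  qed
  ultimately have "(\<lambda>n. measure N {x. h x < 1 / Suc n}) \<longlonglongrightarrow> measure N C" by simp
  then have "\<forall>\<^sub>F n in sequentially. measure N {x. h x < 1 / Suc n} < measure N C + \<epsilon>"
    by (rule order_tendstoD) (use \<open>0 < \<epsilon>\<close> in auto)
  then obtain n where n: "measure N {x. h x < 1 / Suc n} < measure N C + \<epsilon>"
    by (auto dest: eventually_happens)
  define f where "f x = max 0 (1 - Suc n * h x)" for x
  have cf: "continuous_on UNIV f"
    unfolding f_def by (intro continuous_intros)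
  have f01: "0 \<le> f x" "f x \<le> 1" for x using h0(1)[of x] by (auto simp: f_def)
  have bf: "bounded (range f)" using f01 by (intro boundedI[of _ 1]) auto
  have int: "integrable M' f" if "prob_space M'" "sets M' = sets borel" for M'
  proof -
    interpret M': prob_space M' by fact
    have "f \<in> borel_measurable M'"
      using borel_measurable_continuous_onI[OF cf] that by (simp cong: measurable_cong_sets)
    then show ?thesis using f01 by (intro M'.integrable_const_bound[where B=1]) auto
  qed
  have C_le: "measure (M i) C \<le> (\<integral>x. f x \<partial>M i)" for i
  proof -
    interpret M: prob_space "M i" by (rule prob)
    have "measure (M i) C = (\<integral>x. indicator C x \<partial>M i)"
      using C prob(2)[of i] by simp
    also have "\<dots> \<le> (\<integral>x. f x \<partial>M i)"
    proof (rule integral_mono)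
      show "indicator C x \<le> f x" for x
        using f01 by (auto simp: indicator_def f_def h0(2)[THEN iffD2])
    qed (use C prob int in \<open>auto simp: M.emeasure_eq_measure\<close>)
    finally show ?thesis .
  qed
  have "(\<integral>x. f x \<partial>N) \<le> (\<integral>x. indicator {x. h x < 1 / Suc n} x \<partial>N)"
  proof (rule integral_mono)
    show "f x \<le> indicator {x. h x < 1 / Suc n} x" for x
      using f01[of x] by (auto simp: f_def indicator_def field_simps max_def)
  qed (use op N int in \<open>auto simp: N.emeasure_eq_measure\<close>)
  also have "\<dots> = measure N {x. h x < 1 / Suc n}"
    using op N by simp
  finally have "(\<integral>x. f x \<partial>N) < measure N C + \<epsilon>" using n by simp
  from order_tendstoD(2)[OF lim[OF cf bf] this] show ?thesis
    by eventually_elim (use C_le order.strict_trans1 in blast)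
qed

text \<open>The upper bound for closed sets is applied to the closures of \<open>A\<close> and of
  its complement. The null frontier means that taking closures adds no mass under \<open>N\<close>,
  so the two bounds meet.\<close>

lemma weak_limit_continuity_set:
  fixes A :: "'a::metric_space set"
  assumes prob: "\<And>i. prob_space (M i)" "\<And>i. sets (M i) = sets borel"
    and N: "prob_space N" "sets N = sets borel"
    and lim: "\<And>f :: 'a \<Rightarrow> real. continuous_on UNIV f \<Longrightarrow> bounded (range f) \<Longrightarrow>
       ((\<lambda>i. \<integral>x. f x \<partial>M i) \<longlongrightarrow> (\<integral>x. f x \<partial>N)) F"
    and A: "A \<in> sets borel" "measure N (frontier A) = 0"
  shows "((\<lambda>i. measure (M i) A) \<longlongrightarrow> measure N A) F"
proof -
  interpret N: prob_space N by fact
  have upper: "\<forall>\<^sub>F i in F. measure (M i) B < measure N B + \<epsilon>"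
    if B: "B \<in> sets borel" "measure N (frontier B) = 0" and "0 < \<epsilon>" for B and \<epsilon> :: real
  proof -
    have "measure N (closure B) \<le> measure N (B \<union> frontier B)"
      using B N closure_subset by (intro N.finite_measure_mono) (auto simp: frontier_def interior_subset[THEN subsetD])
    also have "\<dots> \<le> measure N B + measure N (frontier B)"
      using B N by (intro measure_Un_le) auto
    finally have le: "measure N (closure B) \<le> measure N B" using B by simp
    have "\<forall>\<^sub>F i in F. measure (M i) (closure B) < measure N (closure B) + \<epsilon>"
      using \<open>0 < \<epsilon>\<close> by (intro weak_limit_closed prob N lim) auto
    then show ?thesis
    proof eventually_elim
      case (elim i)
      interpret M: prob_space "M i" by (rule prob)
      have "measure (M i) B \<le> measure (M i) (closure B)"
        using prob(2)[of i] closure_subset by (intro M.finite_measure_mono) auto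
      then show ?case using elim le by linarith
    qed
  qed
  have compl: "measure M' (- B) = 1 - measure M' B"
    if "prob_space M'" "sets M' = sets borel" "B \<in> sets borel" for M' and B :: "'a set"
  proof -
    interpret M': prob_space M' by fact
    have "space M' = UNIV" using that by (metis sets_eq_imp_space_eq space_borel)
    then show ?thesis using M'.prob_compl[of B] that by (simp add: Compl_eq_Diff_UNIV)
  qed
  show ?thesis
  proof (rule tendstoI)
    fix \<epsilon> :: real assume "0 < \<epsilon>"
    have "- A \<in> sets borel" "measure N (frontier (- A)) = 0"
      using A by (auto simp: frontier_complement)
    from upper[OF A \<open>0 < \<epsilon>\<close>] upper[OF this \<open>0 < \<epsilon>\<close>]
    show "\<forall>\<^sub>F i in F. dist (measure (M i) A) (measure N A) < \<epsilon>"
      by eventually_elim (use compl[OF prob A(1)] compl[OF N A(1)] in \<open>auto simp: dist_real_def\<close>)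
  qed
qed

text \<open>By Tychonoff the cube is compact, so the image of \<open>F\<close> under
  \<open>v\<close> has a cluster point \<open>g\<close>. A filter replaces a subsequence because
  \<open>'k\<close> will be a type of sets, and a cube with uncountably many coordinates need not be
  sequentially compact.\<close>

lemma exists_cluster_filter:
  fixes v :: "'i \<Rightarrow> 'k \<Rightarrow> real"
  assumes "F \<noteq> bot" and v: "\<And>i k. v i k \<in> {a..b}"
  shows "\<exists>F' g. F' \<le> F \<and> F' \<noteq> bot \<and> (\<forall>k. ((\<lambda>i. v i k) \<longlongrightarrow> g k) F')"
proof -
  have "compactin (product_topology (\<lambda>k::'k. euclidean :: real topology) UNIV) (PiE UNIV (\<lambda>k. {a..b}))"
    by (subst compactin_PiE) auto
  then have comp: "compact (PiE UNIV (\<lambda>k::'k. {a..b}))"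
    by (simp add: euclidean_product_topology)
  have "filtermap v F \<noteq> bot" "\<forall>\<^sub>F x in filtermap v F. x \<in> PiE UNIV (\<lambda>k::'k. {a..b})"
    using assms by (auto simp: filtermap_bot_iff eventually_filtermap intro!: always_eventually)
  then obtain g where g: "inf (nhds g) (filtermap v F) \<noteq> bot"
    using comp unfolding compact_filter by blast
  \<comment> \<open>Refining \<open>F\<close> by the preimages of neighbourhoods of \<open>g\<close>
    forces convergence. It stays nontrivial because otherwise \<open>v\<close> would eventually
    avoid some neighbourhood of the cluster point.\<close>
  define F' where "F' = inf F (filtercomap v (nhds g))"
  have "F' \<noteq> bot"
  proof
    assume "F' = bot"
    then have "\<forall>\<^sub>F x in F'. False" by simp
    then obtain P Q where PQ: "eventually P F" "eventually Q (nhds g)" "\<And>i. P i \<Longrightarrow> Q (v i) \<Longrightarrow> False"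
      unfolding F'_def eventually_inf eventually_filtercomap by metis
    have "eventually (\<lambda>x. \<not> Q x) (filtermap v F)"
      unfolding eventually_filtermap using PQ(1) by eventually_elim (use PQ(3) in blast)
    then have "\<forall>\<^sub>F x in inf (nhds g) (filtermap v F). False"
      using PQ(2) unfolding eventually_inf by blast
    then show False using g by (simp add: trivial_limit_def)
  qed
  moreover have "((\<lambda>i. v i k) \<longlongrightarrow> g k) F'" for k
  proof -
    have v: "(v \<longlongrightarrow> g) F'"
      unfolding F'_def filterlim_iff_le_filtercomap by simp
    show ?thesis
    proof (rule topological_tendstoI)
      fix S :: "real set" assume S: "open S" "g k \<in> S"
      have "open ((\<lambda>x::'k \<Rightarrow> real. x k) -` S)"
        using S(1) continuous_on_product_coordinates by (rule open_vimage)
      from topological_tendstoD[OF v this] S(2) show "\<forall>\<^sub>F i in F'. v i k \<in> S" by simp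
    qed
  qed
  ultimately show ?thesis unfolding F'_def by (intro exI[of _ F'] exI[of _ g]) (auto simp: F'_def)
qed

text \<open>Spheres around \<open>p\<close> are level sets of the distance from \<open>p\<close>, so
  arbitrarily small balls have null frontier: the open continuity sets form a base.\<close>

lemma continuity_base:
  fixes U :: "'a::{metric_space, second_countable_topology} set"
  assumes "finite_measure M" and M: "sets M = sets borel" and U: "open U" "p \<in> U"
  shows "\<exists>A. open A \<and> measure M (frontier A) = 0 \<and> p \<in> A \<and> A \<subseteq> U"
proof -
  interpret finite_measure M by fact
  have spM: "space M = UNIV" using M by (metis sets_eq_imp_space_eq space_borel)
  obtain e where e: "0 < e" "ball p e \<subseteq> U" using U by (auto simp: open_contains_ball)
  have "dist p \<in> borel_measurable M"
    using M by (auto cong: measurable_cong_sets)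
  from exists_level_null[OF assms(1) this e(1)] spM
  obtain \<delta> where \<delta>: "0 < \<delta>" "\<delta> < e" "measure M (sphere p \<delta>) = 0"
    by (auto simp: sphere_def)
  have "frontier (ball p \<delta>) \<subseteq> sphere p \<delta>"
    using closure_minimal[OF ball_subset_cball[of p \<delta>] closed_cball] by (auto simp: frontier_def interior_open)
  then have "measure M (frontier (ball p \<delta>)) \<le> measure M (sphere p \<delta>)"
    using M by (intro finite_measure_mono)
      (auto simp: sphere_def intro!: borel_closed closed_Collect_eq continuous_intros)
  then have "measure M (frontier (ball p \<delta>)) = 0"
    using \<delta>(3) measure_nonneg[of M "frontier (ball p \<delta>)"] by linarith
  then show ?thesis
    using e \<delta> by (intro exI[of _ "ball p \<delta>"]) auto
qed

section \<open>Couplings: marginals, construction from finitely additive functions, and cluster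
  points\<close>

lemma couplings_prob_space:
  assumes "\<gamma> \<in> couplings \<mu> \<nu>" "prob_space \<mu>"
  shows "prob_space \<gamma>"
proof (rule prob_space_distrD)
  show "fst \<in> measurable \<gamma> \<mu>" using assms(1) by (auto simp: couplings_def cong: measurable_cong_sets)
  show "prob_space (distr \<gamma> \<mu> fst)" using assms by (auto simp: couplings_def)
qed

lemma couplings_fst:
  assumes "\<gamma> \<in> couplings \<mu> \<nu>" "A \<in> sets \<mu>"
  shows "measure \<gamma> (A \<times> space \<nu>) = measure \<mu> A"
proof -
  have s: "sets \<gamma> = sets (\<mu> \<Otimes>\<^sub>M \<nu>)" and d: "distr \<gamma> \<mu> fst = \<mu>" using assms by (auto simp: couplings_def)
  have "measure \<mu> A = measure \<gamma> (fst -` A \<inter> space \<gamma>)"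
    using assms s by (subst d[symmetric], subst measure_distr) (auto cong: measurable_cong_sets)
  also have "fst -` A \<inter> space \<gamma> = A \<times> space \<nu>"
    using sets_eq_imp_space_eq[OF s] sets.sets_into_space[OF assms(2)] by (auto simp: space_pair_measure)
  finally show ?thesis ..
qed

lemma couplings_snd:
  assumes "\<gamma> \<in> couplings \<mu> \<nu>" "B \<in> sets \<nu>"
  shows "measure \<gamma> (space \<mu> \<times> B) = measure \<nu> B"
proof -
  have s: "sets \<gamma> = sets (\<mu> \<Otimes>\<^sub>M \<nu>)" and d: "distr \<gamma> \<nu> snd = \<nu>" using assms by (auto simp: couplings_def)
  have "measure \<nu> B = measure \<gamma> (snd -` B \<inter> space \<gamma>)"
    using assms s by (subst d[symmetric], subst measure_distr) (auto cong: measurable_cong_sets)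
  also have "snd -` B \<inter> space \<gamma> = space \<mu> \<times> B"
    using sets_eq_imp_space_eq[OF s] sets.sets_into_space[OF assms(2)] by (auto simp: space_pair_measure)
  finally show ?thesis ..
qed

text \<open>Open continuity sets are stable under intersection, since the frontier of an
  intersection lies in the union of the frontiers. They form a base, so by Lindelof they generate
  the Borel sets.\<close>

lemma finite_measure_eqI_continuity_open:
  fixes M N :: "'a::{metric_space, second_countable_topology} measure"
  assumes N: "prob_space N" "sets N = sets borel" and M: "prob_space M" "sets M = sets borel"
    and eq: "\<And>A. open A \<Longrightarrow> measure N (frontier A) = 0 \<Longrightarrow> measure M A = measure N A"
  shows "M = N"
proof (rule measure_eqI_generator_eq)
  interpret N: prob_space N by fact
  interpret M: prob_space M by fact
  let ?E = "{A. open A \<and> measure N (frontier A) = 0}"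
  show "Int_stable ?E"
  proof (rule Int_stableI)
    fix A B assume AB: "A \<in> ?E" "B \<in> ?E"
    have "measure N (frontier (A \<inter> B)) \<le> measure N (frontier A \<union> frontier B)"
      using N frontier_Int_subset by (intro N.finite_measure_mono) auto
    also have "\<dots> \<le> measure N (frontier A) + measure N (frontier B)"
      using N by (intro measure_Un_le) auto
    finally have "measure N (frontier (A \<inter> B)) = 0"
      using AB by (auto intro: antisym)
    then show "A \<inter> B \<in> ?E" using AB by auto
  qed
  show "emeasure M A = emeasure N A" if "A \<in> ?E" for A
    using eq that by (auto simp: M.emeasure_eq_measure N.emeasure_eq_measure)
  have "sigma_sets UNIV ?E = sets borel"
  proof (rule antisym)
    show "sigma_sets UNIV ?E \<subseteq> sets borel"
      using sets.sigma_sets_subset[of ?E borel] by (simp add: subset_eq)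
    have "U \<in> sigma_sets UNIV ?E" if U: "open U" for U
    proof -
      obtain \<A> where \<A>: "\<A> \<subseteq> {A \<in> ?E. A \<subseteq> U}" "countable \<A>" "\<Union>\<A> = \<Union>{A \<in> ?E. A \<subseteq> U}"
        using Lindelof[of "{A \<in> ?E. A \<subseteq> U}"] by auto
      have "\<Union>\<A> = U"
        unfolding \<A>(3) using continuity_base[OF _ N(2) U] N.finite_measure_axioms by blast
      moreover have "\<Union>\<A> \<in> sigma_sets UNIV ?E"
        using \<A> by (intro sigma_algebra.countable_Union[OF sigma_algebra_sigma_sets]) auto
      ultimately show ?thesis by simp
    qed
    then show "sets borel \<subseteq> sigma_sets UNIV ?E"
      unfolding borel_def by (auto intro!: sigma_sets_mono)
  qed
  then show "sets M = sigma_sets UNIV ?E" "sets N = sigma_sets UNIV ?E"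
    using M N by auto
  show "range (\<lambda>_::nat. UNIV) \<subseteq> ?E" by auto
qed (use M prob_space.finite_measure finite_measure.emeasure_finite in auto)

text \<open>Ulam's theorem: a single probability measure on a Polish space is tight, here read off
  from inner regularity.\<close>

lemma exists_compact_measure_gt:
  fixes N :: "'a::polish_space measure"
  assumes "prob_space N" "sets N = sets borel" "0 < \<epsilon>"
  shows "\<exists>K. compact K \<and> measure N K > 1 - \<epsilon>"
proof -
  interpret N: prob_space N by fact
  have sp: "space N = UNIV" using assms by (metis sets_eq_imp_space_eq space_borel)
  have "1 - \<epsilon> < (SUP K \<in> {K. K \<subseteq> UNIV \<and> compact K}. emeasure N K)"
    using inner_regular[OF assms(2), of UNIV] N.emeasure_space_1 sp \<open>0 < \<epsilon>\<close>
    by (simp add: ennreal_less_one_iff)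
  then obtain K where K: "compact K" "ennreal (1 - \<epsilon>) < emeasure N K"
    unfolding less_SUP_iff by auto
  then have "1 - \<epsilon> < measure N K"
    unfolding N.emeasure_eq_measure
    by (metis ennreal_leI ennreal_less_iff leI measure_nonneg not_less order.strict_trans2 ennreal_neg)
  then show ?thesis using K by auto
qed

text \<open>\<open>g\<close> plays the role of a setwise limit of couplings, with marginals known
  only on continuity sets. It need not be countably additive on all Borel sets, but it is so on the
  algebra \<open>R\<close> below, and Caratheodory extends it from there to a measure. On open sets
  only an inequality survives, because in the limit mass may move from an open set to its
  boundary.\<close>

lemma exists_coupling_of_finitely_additive:
  fixes \<mu> :: "'a::polish_space measure" and \<nu> :: "'b::polish_space measure"
    and g :: "('a \<times> 'b) set \<Rightarrow> real"
  assumes \<mu>: "prob_space \<mu>" "sets \<mu> = sets borel" and \<nu>: "prob_space \<nu>" "sets \<nu> = sets borel"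
    and nonneg: "\<And>S. S \<in> sets borel \<Longrightarrow> 0 \<le> g S"
    and add: "\<And>S T. S \<in> sets borel \<Longrightarrow> T \<in> sets borel \<Longrightarrow> S \<inter> T = {} \<Longrightarrow> g (S \<union> T) = g S + g T"
    and fst: "\<And>A. A \<in> sets borel \<Longrightarrow> measure \<mu> (frontier A) = 0 \<Longrightarrow> g (A \<times> UNIV) = measure \<mu> A"
    and snd: "\<And>B. B \<in> sets borel \<Longrightarrow> measure \<nu> (frontier B) = 0 \<Longrightarrow> g (UNIV \<times> B) = measure \<nu> B"
  shows "\<exists>\<gamma> \<in> couplings \<mu> \<nu>. \<forall>U. open U \<longrightarrow> measure \<gamma> U \<le> g U"
proof -
  interpret \<mu>: prob_space \<mu> by fact
  interpret \<nu>: prob_space \<nu> by fact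
  have sp: "space \<mu> = UNIV" "space \<nu> = UNIV" using \<mu> \<nu> by (metis sets_eq_imp_space_eq space_borel)+
  have borel_times: "A \<times> B \<in> sets borel" if "A \<in> sets borel" "B \<in> sets borel" for A :: "'a set" and B :: "'b set"
    unfolding borel_prod[symmetric] using that by auto
  have empty: "g {} = 0" using add[of "{}" "{}"] by simp
  have diff: "g (S - T) = g S - g T" if "S \<in> sets borel" "T \<in> sets borel" "T \<subseteq> S" for S T
    using add[of T "S - T"] that by (auto simp: Un_absorb1)
  have mono: "g T \<le> g S" if "S \<in> sets borel" "T \<in> sets borel" "T \<subseteq> S" for S T
    using diff[OF that] nonneg[of "S - T"] that by auto
  have subadd: "g (S \<union> T) \<le> g S + g T" if "S \<in> sets borel" "T \<in> sets borel" for S T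
    using add[of S "T - S"] mono[of T "T - S"] that by (auto simp: Un_Diff_cancel)

  \<comment> \<open>The Jordan measurable sets for \<open>g\<close>. Members are approximated from inside by closed sets, which
    need not lie in \<open>R\<close> because \<open>g\<close> is defined on all Borel sets.\<close>
  define R where "R = {S \<in> sets borel. \<forall>\<epsilon>>0. \<exists>C Z. closed C \<and> open Z \<and> C \<subseteq> S \<and> S \<subseteq> Z \<and> g (Z - C) < \<epsilon>}"
  have R_borel: "S \<in> sets borel" if "S \<in> R" for S using that by (simp add: R_def)
  have R_compl: "- S \<in> R" if S: "S \<in> R" for S
  proof -
    have "\<exists>C' Z'. closed C' \<and> open Z' \<and> C' \<subseteq> - S \<and> - S \<subseteq> Z' \<and> g (Z' - C') < \<epsilon>" if "0 < \<epsilon>" for \<epsilon>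
    proof -
      obtain C Z where "closed C" "open Z" "C \<subseteq> S" "S \<subseteq> Z" "g (Z - C) < \<epsilon>"
        using S \<open>0 < \<epsilon>\<close> unfolding R_def by blast
      moreover have "- C - - Z = Z - C" by auto
      ultimately show ?thesis by (intro exI[of _ "- Z"] exI[of _ "- C"]) auto
    qed
    then show ?thesis using S unfolding R_def by auto
  qed
  have R_Un: "S \<union> T \<in> R" if S: "S \<in> R" and T: "T \<in> R" for S T
  proof -
    have "\<exists>C' Z'. closed C' \<and> open Z' \<and> C' \<subseteq> S \<union> T \<and> S \<union> T \<subseteq> Z' \<and> g (Z' - C') < \<epsilon>" if "0 < \<epsilon>" for \<epsilon>
    proof -
      obtain C Z where C: "closed C" "open Z" "C \<subseteq> S" "S \<subseteq> Z" "g (Z - C) < \<epsilon> / 2"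
        using S half_gt_zero[OF \<open>0 < \<epsilon>\<close>] unfolding R_def by blast
      obtain D P where D: "closed D" "open P" "D \<subseteq> T" "T \<subseteq> P" "g (P - D) < \<epsilon> / 2"
        using T half_gt_zero[OF \<open>0 < \<epsilon>\<close>] unfolding R_def by blast
      have "g ((Z \<union> P) - (C \<union> D)) \<le> g ((Z - C) \<union> (P - D))"
        using C D by (intro mono) auto
      also have "\<dots> \<le> g (Z - C) + g (P - D)"
        using C D by (intro subadd) auto
      finally show ?thesis
        using C D by (intro exI[of _ "C \<union> D"] exI[of _ "Z \<union> P"]) auto
    qed
    then show ?thesis using S T unfolding R_def by auto
  qed
  have R_empty: "{} \<in> R"
    unfolding R_def using empty by (auto intro!: exI[of _ "{}"])
  have R_Diff: "S - T \<in> R" if "S \<in> R" "T \<in> R" for S T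
  proof -
    have "- (- S \<union> T) \<in> R" using that R_compl R_Un by blast
    moreover have "- (- S \<union> T) = S - T" by auto
    ultimately show ?thesis by metis
  qed
  have R_Int: "S \<inter> T \<in> R" if "S \<in> R" "T \<in> R" for S T
    using R_Diff[OF that(1) R_compl[OF that(2)]] by (simp add: Diff_eq)
  interpret R: ring_of_sets UNIV R
    by (rule ring_of_setsI) (auto intro: R_empty R_Un R_Diff)

  \<comment> \<open>\<open>A\<close> lies between the closed set \<open>closure F\<close> and the
    open set \<open>- closure G\<close>, and the gap is contained in
    \<open>- (F \<union> G)\<close>. This set has to be a continuity set as well as small, because
    the value of \<open>g\<close> on a strip is known only over continuity sets.\<close>
  have sandwich: "\<exists>F G. open F \<and> open G \<and> closure F \<subseteq> A \<and> A \<subseteq> - closure G \<and>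
      measure M (frontier (F \<union> G)) = 0 \<and> measure M (- (F \<union> G)) < \<epsilon>"
    if M: "prob_space M" "sets M = sets borel" and A: "A \<in> sets borel" "measure M (frontier A) = 0" and "0 < \<epsilon>"
    for M :: "'c::polish_space measure" and A and \<epsilon> :: real
  proof -
    interpret M: prob_space M by fact
    obtain F where F: "open F" "closure F \<subseteq> interior A" "measure M (frontier F) = 0" "measure M (interior A - F) < \<epsilon> / 2"
      using open_inner_continuity_set[OF _ M(2), of "interior A" "\<epsilon> / 2"] \<open>0 < \<epsilon>\<close> M.finite_measure_axioms by auto
    obtain G where G: "open G" "closure G \<subseteq> - closure A" "measure M (frontier G) = 0" "measure M (- closure A - G) < \<epsilon> / 2"
      using open_inner_continuity_set[OF _ M(2), of "- closure A" "\<epsilon> / 2"] \<open>0 < \<epsilon>\<close> M.finite_measure_axioms by auto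
    have "measure M (frontier (F \<union> G)) \<le> measure M (frontier F \<union> frontier G)"
      using M frontier_Un_subset by (intro M.finite_measure_mono) auto
    also have "\<dots> \<le> measure M (frontier F) + measure M (frontier G)"
      using M by (intro measure_Un_le) auto
    finally have fr: "measure M (frontier (F \<union> G)) = 0"
      using F G by (auto intro: antisym)
    have "measure M (- (F \<union> G)) \<le> measure M ((interior A - F) \<union> (- closure A - G) \<union> frontier A)"
      using M F G by (intro M.finite_measure_mono) (auto simp: frontier_def)
    also have "\<dots> \<le> measure M ((interior A - F) \<union> (- closure A - G)) + measure M (frontier A)"
      using M F G by (intro measure_Un_le) auto
    also have "\<dots> \<le> measure M (interior A - F) + measure M (- closure A - G) + measure M (frontier A)"
      using M F G by (intro add_right_mono measure_Un_le) auto
    finally have "measure M (- (F \<union> G)) < \<epsilon>" using F G A by linarith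
    then show ?thesis
      using F G fr interior_subset[of A] closure_subset[of A] by (intro exI[of _ F] exI[of _ G]) auto
  qed
  have R_fst: "A \<times> UNIV \<in> R" if A: "A \<in> sets borel" "measure \<mu> (frontier A) = 0" for A
  proof -
    have "\<exists>C Z. closed C \<and> open Z \<and> C \<subseteq> A \<times> UNIV \<and> A \<times> UNIV \<subseteq> Z \<and> g (Z - C) < \<epsilon>" if "0 < \<epsilon>" for \<epsilon>
    proof -
      obtain F G where FG: "open F" "open G" "closure F \<subseteq> A" "A \<subseteq> - closure G"
        "measure \<mu> (frontier (F \<union> G)) = 0" "measure \<mu> (- (F \<union> G)) < \<epsilon>"
        using sandwich[OF \<mu> A \<open>0 < \<epsilon>\<close>] by blast
      have "g ((- closure G) \<times> UNIV - closure F \<times> UNIV) \<le> g ((- (F \<union> G)) \<times> UNIV)"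
        using FG closure_subset[of F] closure_subset[of G] by (intro mono) (auto intro!: borel_times)
      also have "\<dots> = measure \<mu> (- (F \<union> G))"
        using FG by (intro fst) (simp_all only: frontier_complement, auto)
      finally show ?thesis
        using FG by (intro exI[of _ "closure F \<times> UNIV"] exI[of _ "(- closure G) \<times> UNIV"])
          (auto intro!: closed_Times open_Times)
    qed
    then show ?thesis using A by (auto simp: R_def borel_times)
  qed
  have R_snd: "UNIV \<times> B \<in> R" if B: "B \<in> sets borel" "measure \<nu> (frontier B) = 0" for B
  proof -
    have "\<exists>C Z. closed C \<and> open Z \<and> C \<subseteq> UNIV \<times> B \<and> UNIV \<times> B \<subseteq> Z \<and> g (Z - C) < \<epsilon>" if "0 < \<epsilon>" for \<epsilon>
    proof -
      obtain F G where FG: "open F" "open G" "closure F \<subseteq> B" "B \<subseteq> - closure G"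
        "measure \<nu> (frontier (F \<union> G)) = 0" "measure \<nu> (- (F \<union> G)) < \<epsilon>"
        using sandwich[OF \<nu> B \<open>0 < \<epsilon>\<close>] by blast
      have "g (UNIV \<times> (- closure G) - UNIV \<times> closure F) \<le> g (UNIV \<times> (- (F \<union> G)))"
        using FG closure_subset[of F] closure_subset[of G] by (intro mono) (auto intro!: borel_times)
      also have "\<dots> = measure \<nu> (- (F \<union> G))"
        using FG by (intro snd) (simp_all only: frontier_complement, auto)
      finally show ?thesis
        using FG by (intro exI[of _ "UNIV \<times> closure F"] exI[of _ "UNIV \<times> (- closure G)"])
          (auto intro!: closed_Times open_Times)
    qed
    then show ?thesis using B by (auto simp: R_def borel_times)
  qed

  \<comment> \<open>Continuity at the empty set: closed inner approximations of the \<open>A n\<close> eventually avoid a compact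
    box carrying almost all of both marginals.\<close>
  have vanish: "\<exists>n. g (A n) < \<epsilon>"
    if A: "range A \<subseteq> R" "decseq A" "(\<Inter>i. A i) = {}" and "0 < \<epsilon>" for A :: "nat \<Rightarrow> ('a \<times> 'b) set" and \<epsilon> :: real
  proof -
    \<comment> \<open>The errors decay geometrically, so that replacing \<open>A n\<close> by the
      intersection of all \<open>C i\<close> with \<open>i \<le> n\<close> costs less than
      \<open>\<epsilon> / 2\<close> for every \<open>n\<close>.\<close>
    have "\<exists>C. closed C \<and> C \<subseteq> A i \<and> g (A i - C) < \<epsilon> / 2 * (1/2) ^ Suc i" for i
    proof -
      have "0 < \<epsilon> / 2 * (1/2) ^ Suc i" using \<open>0 < \<epsilon>\<close> by simp
      moreover have "A i \<in> R" using A by auto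
      ultimately obtain C Z where C: "closed C" "open Z" "C \<subseteq> A i" "A i \<subseteq> Z" "g (Z - C) < \<epsilon> / 2 * (1/2) ^ Suc i"
        unfolding R_def by blast
      have "g (A i - C) \<le> g (Z - C)"
        using C R_borel[OF \<open>A i \<in> R\<close>] by (intro mono) auto
      then show ?thesis using C by (intro exI[of _ C]) auto
    qed
    then obtain C where C: "\<And>i. closed (C i)" "\<And>i. C i \<subseteq> A i" "\<And>i. g (A i - C i) < \<epsilon> / 2 * (1/2) ^ Suc i"
      by metis
    have [measurable]: "C i \<in> sets borel" "A i \<in> sets borel" for i using C(1)[of i] A(1) R_borel by auto
    have inter[measurable]: "(\<Inter>i\<le>n. C i) \<in> sets borel" for n :: nat by measurable
    have loss: "g (A n - (\<Inter>i\<le>n. C i)) \<le> \<epsilon> / 2 * (1 - (1/2) ^ Suc n)" for n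
    proof (induction n)
      case 0
      then show ?case using C(3)[of 0] by (simp add: less_imp_le)
    next
      case (Suc n)
      have "g (A (Suc n) - (\<Inter>i\<le>Suc n. C i)) \<le> g ((A n - (\<Inter>i\<le>n. C i)) \<union> (A (Suc n) - C (Suc n)))"
        using decseqD[OF A(2), of n "Suc n"] by (intro mono) (auto simp: atMost_Suc)
      also have "\<dots> \<le> g (A n - (\<Inter>i\<le>n. C i)) + g (A (Suc n) - C (Suc n))"
        by (intro subadd) auto
      also have "\<dots> \<le> \<epsilon> / 2 * (1 - (1/2) ^ Suc n) + \<epsilon> / 2 * (1/2) ^ Suc (Suc n)"
        using Suc C(3)[of "Suc n"] by (intro add_mono) auto
      also have "\<dots> = \<epsilon> / 2 * (1 - (1/2) ^ Suc (Suc n))" by (simp add: field_simps)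
      finally show ?case .
    qed
    obtain K where K: "compact K" "measure \<mu> K > 1 - \<epsilon> / 8"
      using exists_compact_measure_gt[OF \<mu>, of "\<epsilon> / 8"] \<open>0 < \<epsilon>\<close> by auto
    obtain L where L: "compact L" "measure \<nu> L > 1 - \<epsilon> / 8"
      using exists_compact_measure_gt[OF \<nu>, of "\<epsilon> / 8"] \<open>0 < \<epsilon>\<close> by auto
    have "\<exists>I. finite I \<and> (K \<times> L) \<inter> (\<Inter>i\<in>I. C i) = {}"
    proof (rule ccontr)
      assume "\<not> ?thesis"
      then have fin: "(K \<times> L) \<inter> (\<Inter>i\<in>I. C i) \<noteq> {}" if "finite I" for I
        using that by blast
      have "(K \<times> L) \<inter> (\<Inter>i\<in>UNIV. C i) \<noteq> {}"
        by (rule compact_imp_fip_image[OF compact_Times[OF K(1) L(1)] C(1) fin])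
      moreover have "(\<Inter>i\<in>UNIV. C i) \<subseteq> (\<Inter>i. A i)"
        using C(2) by (rule INF_mono')
      ultimately show False using A(3) by (metis Int_empty_right subset_empty)
    qed
    then obtain I where I: "finite I" "(K \<times> L) \<inter> (\<Inter>i\<in>I. C i) = {}" by auto
    then obtain n where n: "I \<subseteq> {..n}" by (meson finite_nat_iff_bounded_le)
    define D where "D = (\<Inter>i\<le>n. C i)"
    have D: "closed D" "(K \<times> L) \<inter> D = {}" "D \<in> sets borel"
    proof -
      show "closed D" unfolding D_def using C(1) by (intro closed_INT) auto
      have "D \<subseteq> (\<Inter>i\<in>I. C i)" using n unfolding D_def by (intro INF_superset_mono) auto
      then show "(K \<times> L) \<inter> D = {}" using I(2) by blast
    qed (simp add: D_def inter)
    \<comment> \<open>The tube lemma: the compact box misses the closed set \<open>D\<close>, so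
      some open box around it misses \<open>D\<close> too.\<close>
    obtain U V where UV: "open U" "open V" "K \<subseteq> U" "L \<subseteq> V" "U \<times> V \<subseteq> - D"
    proof (rule Wallace_theorem_prod_topology)
      show "compactin euclidean K" "compactin euclidean L" using K L by auto
      show "openin (prod_topology euclidean euclidean) (- D)"
        using D by (simp add: open_Compl)
    qed (use D in auto)
    \<comment> \<open>The sides of the open box are shrunk to continuity sets. One
      \<open>\<epsilon> / 8\<close> is lost outside the compact set and another by shrinking. The
      hypotheses \<open>fst\<close> and \<open>snd\<close> can then evaluate \<open>g\<close> on the
      two complementary strips, which cover \<open>D\<close>.\<close>
    have shrink: "\<exists>E. open E \<and> E \<subseteq> W \<and> measure M (frontier E) = 0 \<and> measure M (- E) < \<epsilon> / 4"
      if M: "prob_space M" "sets M = sets borel" "open W" "Q \<subseteq> W" "compact Q" "measure M Q > 1 - \<epsilon> / 8"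
      for M :: "'c::polish_space measure" and W Q
    proof -
      interpret M: prob_space M by fact
      have spM: "space M = UNIV" using M by (metis sets_eq_imp_space_eq space_borel)
      obtain E where E: "open E" "closure E \<subseteq> W" "measure M (frontier E) = 0" "measure M (W - E) < \<epsilon> / 8"
        using open_inner_continuity_set[OF _ M(2,3), of "\<epsilon> / 8"] \<open>0 < \<epsilon>\<close> M.finite_measure_axioms by auto
      have "measure M Q \<le> measure M W"
        using M by (intro M.finite_measure_mono) auto
      moreover have "E \<subseteq> W" using E closure_subset by blast
      moreover have "measure M (W - E) = measure M W - measure M E"
        using E M \<open>E \<subseteq> W\<close> by (intro M.finite_measure_Diff) auto
      moreover have "measure M (- E) = 1 - measure M E"
        using M.prob_compl[of E] E M spM by (simp add: Compl_eq_Diff_UNIV)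
      ultimately show ?thesis using E M by (intro exI[of _ E]) auto
    qed
    obtain E where E: "open E" "E \<subseteq> U" "measure \<mu> (frontier E) = 0" "measure \<mu> (- E) < \<epsilon> / 4"
      using shrink[OF \<mu> UV(1,3) K] by auto
    obtain H where H: "open H" "H \<subseteq> V" "measure \<nu> (frontier H) = 0" "measure \<nu> (- H) < \<epsilon> / 4"
      using shrink[OF \<nu> UV(2,4) L] by auto
    have "g D \<le> g ((- E) \<times> UNIV \<union> UNIV \<times> (- H))"
    proof (rule mono)
      have "\<not> p \<in> E \<times> H" if "p \<in> D" for p
        using that UV(5) E(2) H(2) by blast
      then show "D \<subseteq> (- E) \<times> UNIV \<union> UNIV \<times> (- H)" by (auto simp: subset_eq)
    qed (use D E H in \<open>auto intro!: borel_times sets.Un\<close>)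
    also have "\<dots> \<le> g ((- E) \<times> UNIV) + g (UNIV \<times> (- H))"
      using E H by (intro subadd) (auto intro!: borel_times)
    also have "g ((- E) \<times> UNIV) = measure \<mu> (- E)"
      using E by (intro fst) (auto simp: frontier_complement)
    also have "g (UNIV \<times> (- H)) = measure \<nu> (- H)"
      using H by (intro snd) (auto simp: frontier_complement)
    finally have gD: "g D < \<epsilon> / 2" using E H by linarith
    have "g (A n) \<le> g (D \<union> (A n - D))"
      using D by (intro mono) auto
    also have "\<dots> \<le> g D + g (A n - D)"
      using D by (intro subadd) auto
    also have "g (A n - D) \<le> \<epsilon> / 2 * (1 - (1/2) ^ Suc n)"
      using loss[of n] by (simp add: D_def)
    also have "\<epsilon> / 2 * (1 - (1/2) ^ Suc n) \<le> \<epsilon> / 2"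
      using \<open>0 < \<epsilon>\<close> by simp
    finally show ?thesis using gD by (intro exI[of _ n]) auto
  qed

  have "\<exists>m :: ('a \<times> 'b) set \<Rightarrow> ennreal. (\<forall>S\<in>R. m S = ennreal (g S)) \<and> measure_space UNIV (sigma_sets UNIV R) m"
  proof (rule R.caratheodory_empty_continuous)
    show "positive R (\<lambda>S. ennreal (g S))" using empty by (simp add: positive_def)
    show "additive R (\<lambda>S. ennreal (g S))"
      by (auto simp: additive_def add R_borel nonneg ennreal_plus)
    show "(\<lambda>i. ennreal (g (A i))) \<longlonglongrightarrow> 0" if A: "range A \<subseteq> R" "decseq A" "(\<Inter>i. A i) = {}" for A
    proof -
      have "(\<lambda>i. g (A i)) \<longlonglongrightarrow> 0"
      proof (rule LIMSEQ_I)
        fix r :: real assume "0 < r"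
        then obtain n where n: "g (A n) < r" using vanish[OF A] by auto
        have "g (A k) \<le> g (A n)" if "n \<le> k" for k
          using decseqD[OF A(2) that] A(1) R_borel by (intro mono) auto
        then show "\<exists>no. \<forall>k\<ge>no. norm (g (A k) - 0) < r"
          using n nonneg[OF R_borel] A(1) by (intro exI[of _ n]) (auto simp: range_subsetD intro: order.strict_trans1)
      qed
      then show ?thesis using tendsto_ennrealI[of "\<lambda>i. g (A i)" 0] by simp
    qed
  qed auto
  then obtain m where m: "\<And>S. S \<in> R \<Longrightarrow> m S = ennreal (g S)" "measure_space UNIV (sigma_sets UNIV R) m"
    by auto
  define \<gamma> where "\<gamma> = measure_of UNIV (sigma_sets UNIV R) m"

  \<comment> \<open>Boxes of open continuity sets lie in \<open>R\<close> and form a base of the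
    product, and Lindelof reduces to countably many of them. This serves both to generate the Borel
    sets and to bound the measure of open sets.\<close>
  have open_cover: "\<exists>\<A>. countable \<A> \<and> \<A> \<subseteq> R \<and> \<Union>\<A> = W" if W: "open W" for W
  proof -
    define E where "E = {S \<in> R. open S \<and> S \<subseteq> W}"
    have "\<exists>S\<in>E. p \<in> S" if "p \<in> W" for p
    proof -
      obtain A B where AB: "open A" "open B" "p \<in> A \<times> B" "A \<times> B \<subseteq> W"
        using open_prod_elim[OF W \<open>p \<in> W\<close>] by blast
      obtain A' where A': "open A'" "measure \<mu> (frontier A') = 0" "fst p \<in> A'" "A' \<subseteq> A"
        using continuity_base[OF _ \<mu>(2) AB(1), of "fst p"] AB \<mu>.finite_measure_axioms by auto
      obtain B' where B': "open B'" "measure \<nu> (frontier B') = 0" "snd p \<in> B'" "B' \<subseteq> B"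
        using continuity_base[OF _ \<nu>(2) AB(2), of "snd p"] AB \<nu>.finite_measure_axioms by auto
      have "(A' \<times> UNIV) \<inter> (UNIV \<times> B') \<in> R"
        using A' B' by (intro R_Int R_fst R_snd) auto
      moreover have "(A' \<times> UNIV) \<inter> (UNIV \<times> B') = A' \<times> B'" by auto
      moreover have "A' \<times> B' \<subseteq> W" using Sigma_mono[OF A'(4) B'(4)] AB(4) by (rule subset_trans)
      ultimately have "A' \<times> B' \<in> E" using A'(1) B'(1) by (simp add: E_def open_Times)
      moreover have "p \<in> A' \<times> B'" using A' B' by (cases p) auto
      ultimately show ?thesis by (rule rev_bexI)
    qed
    then have "W \<subseteq> \<Union>E" by (meson UnionI subsetI)
    moreover have "\<Union>E \<subseteq> W" by (rule Union_least) (simp add: E_def)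
    moreover obtain \<A> where "\<A> \<subseteq> E" "countable \<A>" "\<Union>\<A> = \<Union>E"
      using Lindelof[of E] by (auto simp: E_def)
    moreover have "E \<subseteq> R" by (auto simp: E_def)
    ultimately show ?thesis by (intro exI[of _ \<A>]) (simp add: subset_antisym)
  qed
  have sigma_R: "sigma_sets UNIV R = sets borel"
  proof (rule antisym)
    show "sigma_sets UNIV R \<subseteq> sets borel"
      using sets.sigma_sets_subset[of R borel] R_borel by (simp add: subset_eq)
    have "W \<in> sigma_sets UNIV R" if W: "open W" for W
    proof -
      obtain \<A> where "countable \<A>" "\<A> \<subseteq> R" "\<Union>\<A> = W" using open_cover[OF W] by blast
      then show ?thesis
        using sigma_algebra.countable_Union[OF sigma_algebra_sigma_sets, of R UNIV \<A>] by auto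
    qed
    then show "sets borel \<subseteq> sigma_sets UNIV R"
      unfolding borel_def by (auto intro!: sigma_sets_mono)
  qed
  have sets_\<gamma>: "sets \<gamma> = sets borel" and sp_\<gamma>: "space \<gamma> = UNIV"
    unfolding \<gamma>_def sigma_R by (metis sets.sigma_sets_eq sets_measure_of space_borel subset_UNIV Pow_UNIV, simp)
  have em: "emeasure \<gamma> S = ennreal (g S)" if "S \<in> R" for S
  proof -
    have "emeasure \<gamma> S = m S"
      using m(2) that unfolding \<gamma>_def measure_space_def
      by (intro emeasure_measure_of_sigma) auto
    then show ?thesis using m(1)[OF that] by simp
  qed
  have UNIV_R: "UNIV \<in> R" using R_compl[OF R_empty] by simp
  have g_UNIV: "g UNIV = 1"
    using fst[of UNIV] \<mu>.prob_space sp by simp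
  interpret \<gamma>: prob_space \<gamma>
    by (rule prob_spaceI) (simp add: sp_\<gamma> em[OF UNIV_R] g_UNIV)
  have meas: "measure \<gamma> S = g S" if "S \<in> R" for S
    using em[OF that] nonneg[OF R_borel[OF that]] by (simp add: measure_def)
  have sets_pair: "sets \<gamma> = sets (\<mu> \<Otimes>\<^sub>M \<nu>)"
    unfolding sets_\<gamma> borel_prod[symmetric] using \<mu> \<nu> by (intro sets_pair_measure_cong) auto
  have [measurable]: "fst \<in> measurable \<gamma> \<mu>" "snd \<in> measurable \<gamma> \<nu>"
    using sets_pair by (auto cong: measurable_cong_sets)
  have "distr \<gamma> \<mu> fst = \<mu>"
  proof (rule finite_measure_eqI_continuity_open[OF \<mu>])
    fix A :: "'a set" assume A: "open A" "measure \<mu> (frontier A) = 0"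
    have "fst -` A \<inter> space \<gamma> = A \<times> UNIV" by (auto simp: sp_\<gamma>)
    then show "measure (distr \<gamma> \<mu> fst) A = measure \<mu> A"
      using A \<mu>(2) by (simp add: measure_distr meas R_fst fst)
  qed (use \<mu> in \<open>auto intro!: \<gamma>.prob_space_distr\<close>)
  moreover have "distr \<gamma> \<nu> snd = \<nu>"
  proof (rule finite_measure_eqI_continuity_open[OF \<nu>])
    fix B :: "'b set" assume B: "open B" "measure \<nu> (frontier B) = 0"
    have "snd -` B \<inter> space \<gamma> = UNIV \<times> B" by (auto simp: sp_\<gamma>)
    then show "measure (distr \<gamma> \<nu> snd) B = measure \<nu> B"
      using B \<nu>(2) by (simp add: measure_distr meas R_snd snd)
  qed (use \<nu> in \<open>auto intro!: \<gamma>.prob_space_distr\<close>)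
  \<comment> \<open>\<open>W\<close> is an increasing union of members \<open>S n\<close> of
    \<open>R\<close>, on which both functions agree. The measure passes to the union, whereas for
    \<open>g\<close> only monotonicity is available, whence the one-sided bound.\<close>
  moreover have "measure \<gamma> W \<le> g W" if W: "open W" for W
  proof (cases "W = {}")
    case False
    obtain \<A> where \<A>: "countable \<A>" "\<A> \<subseteq> R" "\<Union>\<A> = W" using open_cover[OF W] by blast
    then have "\<A> \<noteq> {}" using False by auto
    define S where "S n = (\<Union>i\<le>n. from_nat_into \<A> i)" for n
    have S: "S n \<in> R" "S n \<subseteq> W" for n
      using \<A> from_nat_into[OF \<open>\<A> \<noteq> {}\<close>] unfolding S_def by (auto intro!: R.finite_UN)
    have "(\<lambda>n. measure \<gamma> (S n)) \<longlonglongrightarrow> measure \<gamma> (\<Union>n. S n)"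
      using S R_borel sets_\<gamma> by (intro \<gamma>.finite_Lim_measure_incseq) (force simp: incseq_def S_def)+
    moreover have "(\<Union>n. S n) = W"
    proof -
      have "(\<Union>n. S n) = (\<Union>i. from_nat_into \<A> i)" unfolding S_def by fastforce
      then show ?thesis using range_from_nat_into[OF \<open>\<A> \<noteq> {}\<close> \<A>(1)] \<A>(3) by simp
    qed
    moreover have "measure \<gamma> (S n) \<le> g W" for n
      using S R_borel W by (simp add: meas) (intro mono, auto)
    ultimately show ?thesis by (auto intro: LIMSEQ_le_const2)
  qed (simp add: nonneg)
  ultimately show ?thesis
    using sets_pair by (auto simp: couplings_def)
qed

text \<open>The coordinates of the cluster filter are all sets of pairs, so the masses converge
  setwise and the limit is finitely additive. The portmanteau theorem identifies its marginals on
  continuity sets, and the preceding construction turns it into a coupling. Tightness enters only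
  through the two limit marginals.\<close>

lemma coupling_cluster:
  fixes \<mu> :: "'i \<Rightarrow> 'a::polish_space measure" and \<nu> :: "'i \<Rightarrow> 'b::polish_space measure"
  assumes "F \<noteq> bot"
    and \<mu>: "\<And>i. prob_space (\<mu> i)" "\<And>i. sets (\<mu> i) = sets borel" "prob_space \<mu>0" "sets \<mu>0 = sets borel"
    and \<nu>: "\<And>i. prob_space (\<nu> i)" "\<And>i. sets (\<nu> i) = sets borel" "prob_space \<nu>0" "sets \<nu>0 = sets borel"
    and \<mu>_lim: "\<And>f :: 'a \<Rightarrow> real. continuous_on UNIV f \<Longrightarrow> bounded (range f) \<Longrightarrow>
       ((\<lambda>i. \<integral>x. f x \<partial>\<mu> i) \<longlongrightarrow> (\<integral>x. f x \<partial>\<mu>0)) F"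
    and \<nu>_lim: "\<And>f :: 'b \<Rightarrow> real. continuous_on UNIV f \<Longrightarrow> bounded (range f) \<Longrightarrow>
       ((\<lambda>i. \<integral>x. f x \<partial>\<nu> i) \<longlongrightarrow> (\<integral>x. f x \<partial>\<nu>0)) F"
    and \<gamma>: "\<And>i. \<gamma> i \<in> couplings (\<mu> i) (\<nu> i)"
  shows "\<exists>F' \<gamma>0. F' \<le> F \<and> F' \<noteq> bot \<and> \<gamma>0 \<in> couplings \<mu>0 \<nu>0 \<and>
    (\<forall>U. open U \<longrightarrow> (\<exists>l. ((\<lambda>i. measure (\<gamma> i) U) \<longlongrightarrow> l) F' \<and> measure \<gamma>0 U \<le> l))"
proof -
  have \<gamma>_prob: "prob_space (\<gamma> i)" for i
    using couplings_prob_space[OF \<gamma> \<mu>(1)] .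
  have sets_\<gamma>: "sets (\<gamma> i) = sets borel" for i
    using \<gamma>[of i] \<mu>(2)[of i] \<nu>(2)[of i] unfolding couplings_def borel_prod[symmetric]
    by (auto cong: sets_pair_measure_cong)
  have sp: "space (\<mu> i) = UNIV" "space (\<nu> i) = UNIV" for i
    using \<mu>(2) \<nu>(2) by (metis sets_eq_imp_space_eq space_borel)+
  have "measure (\<gamma> i) S \<in> {0..1}" for i S
    using prob_space.prob_le_1[OF \<gamma>_prob] by simp
  from exists_cluster_filter[OF \<open>F \<noteq> bot\<close>, of "\<lambda>i. measure (\<gamma> i)", OF this]
  obtain F' g where F': "F' \<le> F" "F' \<noteq> bot" and g: "\<And>S. ((\<lambda>i. measure (\<gamma> i) S) \<longlongrightarrow> g S) F'"
    by blast
  have "\<exists>\<gamma>0\<in>couplings \<mu>0 \<nu>0. \<forall>U. open U \<longrightarrow> measure \<gamma>0 U \<le> g U"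
  proof (rule exists_coupling_of_finitely_additive[OF \<mu>(3,4) \<nu>(3,4)])
    show "0 \<le> g S" for S
      using F'(2) g by (rule tendsto_lowerbound[rotated 2]) simp
    show "g (S \<union> T) = g S + g T" if "S \<in> sets borel" "T \<in> sets borel" "S \<inter> T = {}" for S T
    proof (rule tendsto_unique[OF F'(2) g])
      have "measure (\<gamma> i) (S \<union> T) = measure (\<gamma> i) S + measure (\<gamma> i) T" for i
      proof -
        interpret prob_space "\<gamma> i" by (rule \<gamma>_prob)
        show ?thesis using that sets_\<gamma> by (intro finite_measure_Union) auto
      qed
      then show "((\<lambda>i. measure (\<gamma> i) (S \<union> T)) \<longlongrightarrow> g S + g T) F'"
        using tendsto_add[OF g g] by simp
    qed
    show "g (A \<times> UNIV) = measure \<mu>0 A" if A: "A \<in> sets borel" "measure \<mu>0 (frontier A) = 0" for A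
    proof (rule tendsto_unique[OF F'(2) g])
      have "((\<lambda>i. measure (\<mu> i) A) \<longlongrightarrow> measure \<mu>0 A) F"
        by (rule weak_limit_continuity_set[OF \<mu> \<mu>_lim A])
      then show "((\<lambda>i. measure (\<gamma> i) (A \<times> UNIV)) \<longlongrightarrow> measure \<mu>0 A) F'"
        using couplings_fst[OF \<gamma>] A sp \<mu>(2) F'(1) by (auto intro: tendsto_mono)
    qed
    show "g (UNIV \<times> B) = measure \<nu>0 B" if B: "B \<in> sets borel" "measure \<nu>0 (frontier B) = 0" for B
    proof (rule tendsto_unique[OF F'(2) g])
      have "((\<lambda>i. measure (\<nu> i) B) \<longlongrightarrow> measure \<nu>0 B) F"
        by (rule weak_limit_continuity_set[OF \<nu> \<nu>_lim B])
      then show "((\<lambda>i. measure (\<gamma> i) (UNIV \<times> B)) \<longlongrightarrow> measure \<nu>0 B) F'"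
        using couplings_snd[OF \<gamma>] B sp \<nu>(2) F'(1) by (auto intro: tendsto_mono)
    qed
  qed
  then show ?thesis using F' g by blast
qed

text \<open>Lower semicontinuity of the transport integral. Up to \<open>1 / n\<close> the cost is a
  finite average of indicators of open superlevel sets, and the mass of each of these can only drop
  in the limit.\<close>

lemma integral_le_cluster:
  fixes k :: "'a::topological_space \<Rightarrow> real"
  assumes F: "F \<noteq> bot"
    and \<gamma>: "\<And>i. prob_space (\<gamma> i)" "\<And>i. sets (\<gamma> i) = sets borel" "prob_space \<gamma>0" "sets \<gamma>0 = sets borel"
    and lim: "\<And>U. open U \<Longrightarrow> \<exists>l. ((\<lambda>i. measure (\<gamma> i) U) \<longlongrightarrow> l) F \<and> measure \<gamma>0 U \<le> l"
    and k: "\<And>z. k z \<in> {0..1}" "\<And>a. closed {z. k z \<le> a}"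
    and le: "\<forall>\<^sub>F i in F. (\<integral>z. k z \<partial>\<gamma> i) \<le> b"
  shows "(\<integral>z. k z \<partial>\<gamma>0) \<le> b"
proof -
  have int_k: "integrable M k" if "prob_space M" "sets M = sets borel" for M
  proof -
    interpret M: prob_space M by fact
    have "k \<in> borel_measurable borel"
      using k(2) by (intro borel_measurableI_le) auto
    then have "k \<in> borel_measurable M" using that by (simp cong: measurable_cong_sets)
    then show ?thesis using k(1) by (intro M.integrable_const_bound[where B=1]) auto
  qed
  have bound: "(\<integral>z. k z \<partial>\<gamma>0) \<le> b + 1 / Suc N" for N
  proof -
    define n where "n = Suc N"
    define U where "U j = {z. k z > real j / real n}" for j
    have U: "open (U j)" for j
      using k(2)[of "real j / real n"] unfolding U_def closed_def by (simp add: Compl_eq not_le)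
    define s where "s z = (\<Sum>j=1..n. indicator (U j) z) / real n" for z
    \<comment> \<open>A staircase below \<open>k\<close> built from open superlevel sets.\<close>
    have s: "s z \<le> k z \<and> k z \<le> s z + 1 / n" for z
    proof -
      have n: "0 < real n" by (simp add: n_def)
      define x where "x = n * k z"
      \<comment> \<open>The number of integers \<open>j \<ge> 1\<close> with \<open>j < x\<close>.
        The superlevel sets are strict, hence the ceiling minus one; for \<open>x = 0\<close> the
        conversion \<open>nat\<close> turns -1 into 0.\<close>
      define m where "m = nat (\<lceil>x\<rceil> - 1)"
      have x: "0 \<le> x" "x \<le> n" using k(1)[of z] n by (auto simp: x_def mult_left_le)
      have m: "real m \<le> x" "x \<le> real m + 1" "real m < x \<or> m = 0"
        using x(1) unfolding m_def by linarith+
      have "z \<in> U j \<longleftrightarrow> real j < x" for j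
        using n by (simp add: U_def x_def divide_less_eq mult.commute)
      moreover have "j \<le> m" if "real j < x" for j using that m(2) by linarith
      moreover have "real j < x" "j \<le> n" if "1 \<le> j" "j \<le> m" for j using that m(3) x(2) by linarith+
      ultimately have "{1..n} \<inter> {j. z \<in> U j} = {1..m}" by fastforce
      then have "(\<Sum>j=1..n. indicator (U j) z) = real m"
        by (simp add: indicator_def sum.If_cases)
      moreover note m(1,2)[unfolded x_def]
      ultimately show ?thesis using n by (simp add: s_def field_simps)
    qed
    have s_int: "integrable M s" "(\<integral>z. s z \<partial>M) = (\<Sum>j=1..n. measure M (U j)) / n"
      if "prob_space M" "sets M = sets borel" for M
    proof -
      interpret M: prob_space M by fact
      have "integrable M (indicator (U j) :: _ \<Rightarrow> real)" for j
        using U that by (auto simp: M.emeasure_eq_measure)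
      then show "integrable M s" "(\<integral>z. s z \<partial>M) = (\<Sum>j=1..n. measure M (U j)) / n"
        unfolding s_def using U that by (auto simp: Bochner_Integration.integral_sum)
    qed
    obtain l where l: "\<And>j. ((\<lambda>i. measure (\<gamma> i) (U j)) \<longlongrightarrow> l j) F" "\<And>j. measure \<gamma>0 (U j) \<le> l j"
      using lim[OF U] by metis
    have "((\<lambda>i. (\<Sum>j=1..n. measure (\<gamma> i) (U j)) / n) \<longlongrightarrow> (\<Sum>j=1..n. l j) / n) F"
      by (intro tendsto_intros l) (simp add: n_def)
    moreover have "\<forall>\<^sub>F i in F. (\<Sum>j=1..n. measure (\<gamma> i) (U j)) / n \<le> b"
      using le
    proof eventually_elim
      case (elim i)
      have "(\<integral>z. s z \<partial>\<gamma> i) \<le> (\<integral>z. k z \<partial>\<gamma> i)"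
        using s s_int(1)[OF \<gamma>(1,2)] int_k[OF \<gamma>(1,2)] by (intro integral_mono) auto
      then show ?case using elim s_int(2)[OF \<gamma>(1,2)] by simp
    qed
    ultimately have lb: "(\<Sum>j=1..n. l j) / n \<le> b"
      by (rule tendsto_upperbound[OF _ _ F])
    interpret \<gamma>0: prob_space \<gamma>0 by (rule \<gamma>)
    have "(\<integral>z. k z \<partial>\<gamma>0) \<le> (\<integral>z. s z + 1 / n \<partial>\<gamma>0)"
      using s s_int(1)[OF \<gamma>(3,4)] int_k[OF \<gamma>(3,4)] by (intro integral_mono) auto
    also have "\<dots> = (\<Sum>j=1..n. measure \<gamma>0 (U j)) / n + 1 / n"
      using s_int[OF \<gamma>(3,4)] by (simp add: \<gamma>0.prob_space)
    also have "\<dots> \<le> (\<Sum>j=1..n. l j) / n + 1 / n"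
      using l(2) by (intro add_right_mono divide_right_mono sum_mono) auto
    finally show ?thesis using lb by (simp add: n_def)
  qed
  have "(\<lambda>N. b + 1 / Suc N) \<longlonglongrightarrow> b + 0"
    by (intro tendsto_intros LIMSEQ_Suc[OF lim_1_over_n])
  then show ?thesis
    using bound by (intro LIMSEQ_le_const[of _ b]) auto
qed

section \<open>Trajectories at rational times\<close>

text \<open>Indexing by the whole countable type \<open>rat\<close> makes
  \<open>rat \<Rightarrow> 'a\<close> a Polish space under the product topology. The absolute value
  keeps the times nonnegative, where trajectories are specified.\<close>

definition rational_path :: "(real \<Rightarrow> 'a) \<Rightarrow> rat \<Rightarrow> 'a" where
  "rational_path \<omega> q = \<omega> \<bar>of_rat q\<bar>"

text \<open>The largest point at or below \<open>t\<close> of the grid of mesh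
  \<open>1 / Suc n\<close>. Being explicit, it allows limits along it to be treated as limits of
  countably many coordinate functions; being at most \<open>t\<close>, it stays inside any interval
  \<open>{0..T}\<close> that contains \<open>t\<close>.\<close>

definition floor_rat :: "nat \<Rightarrow> real \<Rightarrow> rat" where
  "floor_rat n t = of_int \<lfloor>real (Suc n) * t\<rfloor> / of_nat (Suc n)"

lemma floor_rat:
  assumes "0 \<le> t"
  shows "0 \<le> floor_rat n t" "of_rat (floor_rat n t) \<le> t" "(\<lambda>n. of_rat (floor_rat n t)) \<longlonglongrightarrow> t"
proof -
  have eq: "(of_rat (floor_rat n t) :: real) = \<lfloor>real (Suc n) * t\<rfloor> / Suc n" for n
    unfolding floor_rat_def by (simp add: of_rat_divide of_rat_add)
  show "0 \<le> floor_rat n t" using assms by (simp add: floor_rat_def)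
  have le: "of_rat (floor_rat n t) \<le> t" for n
    unfolding eq by (simp add: divide_le_eq mult.commute)
  then show "of_rat (floor_rat n t) \<le> t" .
  have ge: "t - 1 / Suc n \<le> of_rat (floor_rat n t)" for n
  proof -
    have "real (Suc n) * t - 1 \<le> \<lfloor>real (Suc n) * t\<rfloor>" by linarith
    then have "(real (Suc n) * t - 1) / Suc n \<le> \<lfloor>real (Suc n) * t\<rfloor> / Suc n"
      by (rule divide_right_mono) simp
    then show ?thesis unfolding eq by (simp add: diff_divide_distrib del: of_nat_Suc)
  qed
  have "(\<lambda>n. t - 1 / Suc n) \<longlonglongrightarrow> t - 0"
    by (intro tendsto_intros LIMSEQ_Suc[OF lim_1_over_n])
  then have "(\<lambda>n. t - 1 / Suc n) \<longlonglongrightarrow> t" by simp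
  from real_tendsto_sandwich[OF _ _ this tendsto_const, of "\<lambda>n. of_rat (floor_rat n t)"]
  show "(\<lambda>n. of_rat (floor_rat n t)) \<longlonglongrightarrow> t"
    using ge le by (auto intro: always_eventually)
qed

section \<open>Recovering trajectories from their values at rational times\<close>

lemma trajectory_eval_measurable:
  assumes "0 \<le> t"
  shows "(\<lambda>\<omega>. \<omega> t) \<in> measurable trajectory_space borel"
  unfolding trajectory_space_def using assms
  by (intro measurable_restrict_space1 measurable_component_singleton) auto

lemma rational_path_measurable [measurable]:
  "rational_path \<in> borel_measurable (trajectory_space :: (real \<Rightarrow> 'a::polish_space) measure)"
  by (rule measurable_coordinatewise_then_product)
    (auto simp: rational_path_def intro: trajectory_eval_measurable)

lemma of_rat_abs_diff: "of_rat \<bar>p - q\<bar> = (\<bar>of_rat p - of_rat q\<bar> :: real)"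
  by (metis abs_of_rat of_rat_diff)

text \<open>The inner absolute values force \<open>f (- q) = f q\<close>, which holds for every rational path.\<close>

definition extendable_paths :: "(rat \<Rightarrow> 'a::metric_space) set" where
  "extendable_paths = {f. \<forall>N k :: nat. \<exists>j :: nat. \<forall>p q. \<bar>p\<bar> \<le> of_nat N \<longrightarrow> \<bar>q\<bar> \<le> of_nat N \<longrightarrow>
     \<bar>\<bar>p\<bar> - \<bar>q\<bar>\<bar> < 1 / of_nat (Suc j) \<longrightarrow> dist (f p) (f q) < 1 / Suc k}"

text \<open>All quantifiers in the definition range over the countable types \<open>nat\<close> and
  \<open>rat\<close>; this is why tolerances are reciprocals of natural numbers.\<close>

lemma extendable_paths_borel: "extendable_paths \<in> sets (borel :: (rat \<Rightarrow> 'a::polish_space) measure)"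
proof -
  have [measurable]: "(\<lambda>f. f p) \<in> borel_measurable (borel :: (rat \<Rightarrow> 'a) measure)" for p
    by (intro borel_measurable_continuous_onI continuous_on_product_coordinates)
  have "{f \<in> space borel. \<forall>N k :: nat. \<exists>j :: nat. \<forall>p q :: rat. \<bar>p\<bar> \<le> of_nat N \<longrightarrow> \<bar>q\<bar> \<le> of_nat N \<longrightarrow>
     \<bar>\<bar>p\<bar> - \<bar>q\<bar>\<bar> < 1 / of_nat (Suc j) \<longrightarrow> dist (f p) (f q) < 1 / Suc k} \<in> sets (borel :: (rat \<Rightarrow> 'a) measure)"
    by measurable
  then show ?thesis by (simp add: extendable_paths_def)
qed

text \<open>A continuous trajectory is uniformly continuous on each compact interval
  \<open>{0..real N}\<close>, and its modulus there serves for the rational times.\<close>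

lemma rational_path_extendable:
  assumes "\<omega> \<in> trajectories"
  shows "rational_path \<omega> \<in> extendable_paths"
  unfolding extendable_paths_def
proof (intro CollectI allI)
  fix N k :: nat
  have "uniformly_continuous_on {0..real N} \<omega>"
    using assms unfolding trajectories_def
    by (intro compact_uniformly_continuous) (auto elim: continuous_on_subset)
  then obtain d where d: "0 < d" "\<And>x y. x \<in> {0..real N} \<Longrightarrow> y \<in> {0..real N} \<Longrightarrow> dist y x < d \<Longrightarrow> dist (\<omega> y) (\<omega> x) < 1 / Suc k"
    unfolding uniformly_continuous_on_def by (metis of_nat_0_less_iff zero_less_Suc zero_less_divide_1_iff)
  obtain j where j: "1 / real (Suc j) < d"
    using reals_Archimedean[OF d(1)] by (auto simp: inverse_eq_divide)
  show "\<exists>j :: nat. \<forall>p q. \<bar>p\<bar> \<le> of_nat N \<longrightarrow> \<bar>q\<bar> \<le> of_nat N \<longrightarrow>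
     \<bar>\<bar>p\<bar> - \<bar>q\<bar>\<bar> < 1 / of_nat (Suc j) \<longrightarrow> dist (rational_path \<omega> p) (rational_path \<omega> q) < 1 / Suc k"
  proof (intro exI[of _ j] allI impI)
    fix p q :: rat
    assume pq: "\<bar>p\<bar> \<le> of_nat N" "\<bar>q\<bar> \<le> of_nat N" "\<bar>\<bar>p\<bar> - \<bar>q\<bar>\<bar> < 1 / of_nat (Suc j)"
    have "of_rat \<bar>p\<bar> \<le> (of_rat (of_nat N) :: real)" "of_rat \<bar>q\<bar> \<le> (of_rat (of_nat N) :: real)"
      "of_rat \<bar>\<bar>p\<bar> - \<bar>q\<bar>\<bar> < (of_rat (1 / of_nat (Suc j)) :: real)"
      using pq unfolding of_rat_less_eq of_rat_less by auto
    then show "dist (rational_path \<omega> p) (rational_path \<omega> q) < 1 / Suc k"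
      unfolding rational_path_def using j
      by (intro d(2)) (auto simp: dist_real_def of_rat_divide of_rat_add of_rat_abs_diff)
  qed
qed

text \<open>Uniform continuity on bounded sets of rationals makes the values along the grid
  approximations of \<open>t\<close> Cauchy, and completeness provides the limit. The modulus of
  continuity then passes from \<open>f\<close> to \<open>\<omega>\<close>.\<close>

lemma extendable_paths_limit:
  fixes f :: "rat \<Rightarrow> 'a::complete_space"
  assumes f: "f \<in> extendable_paths"
  defines "\<omega> \<equiv> \<lambda>t\<in>{0..}. lim (\<lambda>n. f (floor_rat n t))"
  shows "\<And>t. 0 \<le> t \<Longrightarrow> (\<lambda>n. f (floor_rat n t)) \<longlonglongrightarrow> \<omega> t" "\<omega> \<in> trajectories" "rational_path \<omega> = f"
proof -
  have modulus: "\<exists>\<delta>>0::real. \<forall>p q. \<bar>of_rat p\<bar> \<le> T \<longrightarrow> \<bar>of_rat q\<bar> \<le> T \<longrightarrow>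
     \<bar>\<bar>of_rat p\<bar> - \<bar>of_rat q\<bar>\<bar> < \<delta> \<longrightarrow> dist (f p) (f q) < \<epsilon>" if "0 < \<epsilon>" for T \<epsilon> :: real
  proof -
    obtain N where N: "T \<le> real N" using real_arch_simple by blast
    obtain k where k: "1 / real (Suc k) < \<epsilon>"
      using reals_Archimedean[OF \<open>0 < \<epsilon>\<close>] by (auto simp: inverse_eq_divide)
    obtain j where j: "\<And>p q. \<bar>p\<bar> \<le> of_nat N \<Longrightarrow> \<bar>q\<bar> \<le> of_nat N \<Longrightarrow>
     \<bar>\<bar>p\<bar> - \<bar>q\<bar>\<bar> < 1 / of_nat (Suc j) \<Longrightarrow> dist (f p) (f q) < 1 / Suc k"
      using f unfolding extendable_paths_def by blast
    have "dist (f p) (f q) < \<epsilon>"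
      if "\<bar>of_rat p\<bar> \<le> T" "\<bar>of_rat q\<bar> \<le> T" "\<bar>\<bar>of_rat p\<bar> - \<bar>of_rat q\<bar>\<bar> < 1 / real (Suc j)" for p q
    proof -
      have "of_rat \<bar>p\<bar> \<le> (of_rat (of_nat N) :: real)" "of_rat \<bar>q\<bar> \<le> (of_rat (of_nat N) :: real)"
        "of_rat \<bar>\<bar>p\<bar> - \<bar>q\<bar>\<bar> < (of_rat (1 / of_nat (Suc j)) :: real)"
        using that N by (auto simp: of_rat_divide of_rat_add of_rat_abs_diff)
      then have "dist (f p) (f q) < 1 / Suc k"
        unfolding of_rat_less_eq of_rat_less by (rule j)
      then show ?thesis using k by linarith
    qed
    then show ?thesis by (intro exI[of _ "1 / real (Suc j)"]) auto
  qed
  show lim: "(\<lambda>n. f (floor_rat n t)) \<longlonglongrightarrow> \<omega> t" if t: "0 \<le> t" for t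
  proof -
    have "Cauchy (\<lambda>n. f (floor_rat n t))"
    proof (rule metric_CauchyI)
      fix \<epsilon> :: real assume "0 < \<epsilon>"
      obtain \<delta> :: real where \<delta>: "0 < \<delta>" "\<And>p q. \<bar>of_rat p\<bar> \<le> t \<Longrightarrow> \<bar>of_rat q\<bar> \<le> t \<Longrightarrow>
        \<bar>\<bar>of_rat p\<bar> - \<bar>of_rat q\<bar>\<bar> < \<delta> \<Longrightarrow> dist (f p) (f q) < \<epsilon>"
        using modulus[OF \<open>0 < \<epsilon>\<close>, of t] by blast
      have "Cauchy (\<lambda>n. of_rat (floor_rat n t) :: real)"
        using floor_rat(3)[OF t] by (rule LIMSEQ_imp_Cauchy)
      from metric_CauchyD[OF this \<delta>(1)] obtain M where
        M: "\<forall>m\<ge>M. \<forall>n\<ge>M. dist (of_rat (floor_rat m t)) (of_rat (floor_rat n t) :: real) < \<delta>" by blast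
      show "\<exists>M. \<forall>m\<ge>M. \<forall>n\<ge>M. dist (f (floor_rat m t)) (f (floor_rat n t)) < \<epsilon>"
      proof (intro exI[of _ M] allI impI)
        fix m n assume "M \<le> m" "M \<le> n"
        then show "dist (f (floor_rat m t)) (f (floor_rat n t)) < \<epsilon>"
          using M floor_rat(1,2)[OF t] by (intro \<delta>(2)) (auto simp: dist_real_def)
      qed
    qed
    then show ?thesis
      using t by (simp add: \<omega>_def Cauchy_convergent convergent_LIMSEQ_iff[symmetric])
  qed
  \<comment> \<open>As \<open>\<bar>s - t\<bar> < \<delta>\<close> is strict, the grid
    approximations of \<open>s\<close> and \<open>t\<close> are eventually within
    \<open>\<delta>\<close> of each other as well; the strict bound on \<open>f\<close> becomes a
    weak one in the limit.\<close>
  have near: "dist (\<omega> s) (\<omega> t) \<le> \<epsilon>"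
    if st: "0 \<le> s" "0 \<le> t" "s \<le> T" "t \<le> T" "\<bar>s - t\<bar> < \<delta>"
      and \<delta>: "\<And>p q. \<bar>of_rat p\<bar> \<le> T \<Longrightarrow> \<bar>of_rat q\<bar> \<le> T \<Longrightarrow>
        \<bar>\<bar>of_rat p\<bar> - \<bar>of_rat q\<bar>\<bar> < \<delta> \<Longrightarrow> dist (f p) (f q) < \<epsilon>" for s t T \<delta> \<epsilon> :: real
  proof (rule tendsto_upperbound[of _ _ sequentially])
    show "(\<lambda>n. dist (f (floor_rat n s)) (f (floor_rat n t))) \<longlonglongrightarrow> dist (\<omega> s) (\<omega> t)"
      by (intro tendsto_dist lim st)
    have "(\<lambda>n. \<bar>of_rat (floor_rat n s) - of_rat (floor_rat n t)\<bar>) \<longlonglongrightarrow> \<bar>s - t\<bar>"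
      by (intro tendsto_intros floor_rat st)
    from order_tendstoD(2)[OF this st(5)]
    show "\<forall>\<^sub>F n in sequentially. dist (f (floor_rat n s)) (f (floor_rat n t)) \<le> \<epsilon>"
    proof eventually_elim
      case (elim n)
      then have "dist (f (floor_rat n s)) (f (floor_rat n t)) < \<epsilon>"
        using floor_rat(1,2)[OF st(1), of n] floor_rat(1,2)[OF st(2), of n] st by (intro \<delta>) auto
      then show ?case by simp
    qed
  qed simp
  have "continuous_on {0..} \<omega>"
    unfolding continuous_on_iff
  proof (intro ballI allI impI)
    fix t \<epsilon> :: real assume t: "t \<in> {0..}" and "0 < \<epsilon>"
    then obtain \<delta> :: real where \<delta>: "0 < \<delta>" "\<And>p q. \<bar>of_rat p\<bar> \<le> t + 1 \<Longrightarrow> \<bar>of_rat q\<bar> \<le> t + 1 \<Longrightarrow>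
        \<bar>\<bar>of_rat p\<bar> - \<bar>of_rat q\<bar>\<bar> < \<delta> \<Longrightarrow> dist (f p) (f q) < \<epsilon> / 2"
      using modulus[of "\<epsilon> / 2" "t + 1"] by auto
    have "dist (\<omega> s) (\<omega> t) < \<epsilon>" if "s \<in> {0..}" "dist s t < min 1 \<delta>" for s
    proof -
      have "dist (\<omega> s) (\<omega> t) \<le> \<epsilon> / 2"
        using that t by (intro near[of s t "t + 1" \<delta>] \<delta>(2)) (auto simp: dist_real_def)
      then show ?thesis using \<open>0 < \<epsilon>\<close> by linarith
    qed
    then show "\<exists>d>0. \<forall>s\<in>{0..}. dist s t < d \<longrightarrow> dist (\<omega> s) (\<omega> t) < \<epsilon>"
      using \<delta>(1) by (intro exI[of _ "min 1 \<delta>"]) auto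
  qed
  then show "\<omega> \<in> trajectories" by (simp add: trajectories_def \<omega>_def)
  show "rational_path \<omega> = f"
  proof
    fix p
    \<comment> \<open>The modulus compares absolute values of times only, so \<open>f\<close> along
      the grid approximations of \<open>T\<close> converges to \<open>f p\<close> also when
      \<open>p\<close> is negative.\<close>
    define T :: real where "T = \<bar>of_rat p\<bar>"
    have T: "0 \<le> T" "\<bar>of_rat p\<bar> \<le> T" by (auto simp: T_def)
    have "(\<lambda>n. f (floor_rat n T)) \<longlonglongrightarrow> f p"
    proof (rule metric_LIMSEQ_I)
      fix \<epsilon> :: real assume "0 < \<epsilon>"
      obtain \<delta> :: real where \<delta>: "0 < \<delta>" "\<And>q r. \<bar>of_rat q\<bar> \<le> T \<Longrightarrow> \<bar>of_rat r\<bar> \<le> T \<Longrightarrow>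
        \<bar>\<bar>of_rat q\<bar> - \<bar>of_rat r\<bar>\<bar> < \<delta> \<Longrightarrow> dist (f q) (f r) < \<epsilon>"
        using modulus[OF \<open>0 < \<epsilon>\<close>, of T] by blast
      from metric_LIMSEQ_D[OF floor_rat(3)[OF T(1)] \<delta>(1)]
      obtain M where M: "\<forall>n\<ge>M. dist (of_rat (floor_rat n T)) T < \<delta>" by blast
      show "\<exists>M. \<forall>n\<ge>M. dist (f (floor_rat n T)) (f p) < \<epsilon>"
      proof (intro exI[of _ M] allI impI)
        fix n assume "M \<le> n"
        then have "\<bar>of_rat (floor_rat n T) - T\<bar> < \<delta>" using M by (simp add: dist_real_def)
        then show "dist (f (floor_rat n T)) (f p) < \<epsilon>"
          using floor_rat(1,2)[OF T(1), of n] T by (intro \<delta>(2)) (auto simp: T_def)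
      qed
    qed
    then have "\<omega> T = f p" using lim[OF T(1)] LIMSEQ_unique by blast
    then show "rational_path \<omega> p = f p" by (simp add: rational_path_def T_def)
  qed
qed

lemma trajectories_eqI:
  assumes "\<omega> \<in> trajectories" "\<omega>' \<in> trajectories" "rational_path \<omega> = rational_path \<omega>'"
  shows "\<omega> = (\<omega>' :: real \<Rightarrow> 'a::t2_space)"
proof (rule extensionalityI[of _ "{0..}"])
  fix t :: real assume t: "t \<in> {0..}"
  have lim: "(\<lambda>n. \<psi> (of_rat (floor_rat n t))) \<longlonglongrightarrow> \<psi> t" if "\<psi> \<in> trajectories" for \<psi> :: "real \<Rightarrow> 'a"
    using that t floor_rat[of t] unfolding trajectories_def
    by (intro continuous_on_tendsto_compose[of "{0..}" \<psi>]) auto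
  have "\<omega> (of_rat (floor_rat n t)) = \<omega>' (of_rat (floor_rat n t))" for n
    using fun_cong[OF assms(3), of "floor_rat n t"] floor_rat(1)[of t n] t by (simp add: rational_path_def)
  then show "\<omega> t = \<omega>' t" using lim[OF assms(1)] lim[OF assms(2)] LIMSEQ_unique by simp
qed (use assms in \<open>auto simp: trajectories_def\<close>)

text \<open>A measurable two-sided inverse between trajectories and the Borel set of extendable
  paths. It carries couplings built on the Polish product back to trajectory space.\<close>

lemma rational_path_inverse:
  obtains s where "s \<in> measurable borel (trajectory_space :: (real \<Rightarrow> 'a::polish_space) measure)"
    and "\<And>\<omega>. \<omega> \<in> trajectories \<Longrightarrow> s (rational_path \<omega>) = \<omega>"
    and "\<And>f. f \<in> extendable_paths \<Longrightarrow> rational_path (s f) = f"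
proof -
  \<comment> \<open>Paths that do not extend are replaced by a constant one, which does. Hence
    \<open>s\<close> takes values in \<open>trajectories\<close> everywhere, as measurability into
    the restricted space demands.\<close>
  define e where "e f = (if f \<in> extendable_paths then f else (\<lambda>_. undefined))" for f :: "rat \<Rightarrow> 'a"
  define s where "s f = (\<lambda>t\<in>{0..}. lim (\<lambda>n. e f (floor_rat n t)))" for f
  have e: "e f \<in> extendable_paths" for f
    by (auto simp: e_def extendable_paths_def)
  note s = extendable_paths_limit[OF e, folded s_def]
  have [measurable]: "(\<lambda>f. f p) \<in> borel_measurable (borel :: (rat \<Rightarrow> 'a) measure)" for p
    by (intro borel_measurable_continuous_onI continuous_on_product_coordinates)
  have "(\<lambda>f. e f p) \<in> borel_measurable borel" for p
  proof -
    have "(\<lambda>f. e f p) = (\<lambda>f. if f \<in> extendable_paths then f p else undefined)"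
      by (auto simp: e_def)
    then show ?thesis using extendable_paths_borel by (auto intro!: measurable_If_set)
  qed
  then have s_meas: "(\<lambda>f. s f t) \<in> borel_measurable borel" if "t \<in> {0..}" for t
    by (rule borel_measurable_LIMSEQ_metric) (rule s(1), use that in simp)
  have "s \<in> measurable borel trajectory_space"
    unfolding trajectory_space_def
  proof (rule measurable_restrict_space2)
    show "s \<in> measurable borel (\<Pi>\<^sub>M t\<in>{0..}. borel)"
    proof (rule measurable_PiM_single'[where f = "\<lambda>t f. s f t"])
      have "s f \<in> extensional {0..}" for f using s(2)[of f] by (simp add: trajectories_def)
      then show "(\<lambda>f t. s f t) \<in> space borel \<rightarrow> (\<Pi>\<^sub>E t\<in>{0..}. space borel)"
        by (simp add: PiE_def Pi_def)
    qed (rule s_meas)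
  qed (use s(2) in auto)
  moreover have "s (rational_path \<omega>) = \<omega>" if \<omega>: "\<omega> \<in> trajectories" for \<omega>
  proof (rule trajectories_eqI[OF s(2) \<omega>])
    show "rational_path (s (rational_path \<omega>)) = rational_path \<omega>"
      unfolding s(3) by (simp add: e_def rational_path_extendable[OF \<omega>])
  qed
  moreover have "rational_path (s f) = f" if "f \<in> extendable_paths" for f
    unfolding s(3) using that by (simp add: e_def)
  ultimately show thesis by (rule that)
qed

text \<open>Lower semicontinuity on the product is stated through closed sublevel sets, a form that
  is stable under suprema since these turn into intersections.\<close>

definition lsc_unit :: "('a::topological_space \<Rightarrow> 'a \<Rightarrow> real) \<Rightarrow> bool" where
  "lsc_unit m \<longleftrightarrow> (\<forall>x y. m x y \<in> {0..1}) \<and> (\<forall>a. closed {z. m (fst z) (snd z) \<le> a})"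

definition rational_sup :: "real \<Rightarrow> ('a \<Rightarrow> 'a \<Rightarrow> real) \<Rightarrow> (rat \<Rightarrow> 'a) \<times> (rat \<Rightarrow> 'a) \<Rightarrow> real" where
  "rational_sup c m z = (SUP q. c powr \<bar>of_rat q\<bar> * m (fst z q) (snd z q))"

section \<open>Discounted suprema over real and over rational times\<close>

lemma discount_le_one:
  assumes "lsc_unit m" "0 < c" "c < 1" "0 \<le> t"
  shows "c powr t * m x y \<in> {0..1}"
proof -
  have "c powr t \<le> 1" using assms by (simp add: powr_le1)
  then show ?thesis using assms(1) by (auto simp: lsc_unit_def intro!: mult_le_one)
qed

lemma rational_sup_le_iff:
  assumes "lsc_unit m" "0 < c" "c < 1"
  shows "rational_sup c m z \<le> a \<longleftrightarrow> (\<forall>q. c powr \<bar>of_rat q\<bar> * m (fst z q) (snd z q) \<le> a)"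
  unfolding rational_sup_def using discount_le_one[OF assms]
  by (subst cSUP_le_iff) (auto intro!: bdd_aboveI[of _ 1])

lemma discounted_sup_le_iff:
  assumes "lsc_unit m" "0 < c" "c < 1"
  shows "discounted_sup c m \<omega> \<omega>' \<le> a \<longleftrightarrow> (\<forall>t\<ge>0. c powr t * m (\<omega> t) (\<omega>' t) \<le> a)"
  unfolding discounted_sup_def using discount_le_one[OF assms]
  by (subst cSUP_le_iff) (auto intro!: bdd_aboveI[of _ 1])

lemma discounted_sup_bounds:
  assumes "lsc_unit m" "0 < c" "c < 1"
  shows "discounted_sup c m \<omega> \<omega>' \<in> {0..1}"
proof -
  have "0 \<le> c powr 0 * m (\<omega> 0) (\<omega>' 0)" using discount_le_one[OF assms] by fastforce
  also have "\<dots> \<le> discounted_sup c m \<omega> \<omega>'"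
    using discounted_sup_le_iff[OF assms, of \<omega> \<omega>' "discounted_sup c m \<omega> \<omega>'"] by auto
  moreover have "discounted_sup c m \<omega> \<omega>' \<le> 1"
    using discount_le_one[OF assms] by (subst discounted_sup_le_iff[OF assms]) auto
  ultimately show ?thesis by simp
qed

lemma rational_sup_bounds:
  assumes "lsc_unit m" "0 < c" "c < 1"
  shows "rational_sup c m z \<in> {0..1}"
proof -
  have "0 \<le> c powr 0 * m (fst z 0) (snd z 0)" using discount_le_one[OF assms] by fastforce
  also have "\<dots> \<le> rational_sup c m z"
    using rational_sup_le_iff[OF assms, of z "rational_sup c m z"] by (metis abs_zero of_rat_0 order_refl)
  moreover have "rational_sup c m z \<le> 1"
    using discount_le_one[OF assms] by (subst rational_sup_le_iff[OF assms]) auto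
  ultimately show ?thesis by simp
qed

text \<open>The sublevel set is an intersection, over rational times, of preimages of sublevel sets
  of \<open>m\<close> under the continuous evaluation of both paths.\<close>

lemma rational_sup_closed:
  assumes "lsc_unit m" "0 < c" "c < 1"
  shows "closed {z. rational_sup c m z \<le> a}"
proof -
  have eq: "{z. rational_sup c m z \<le> a} =
      (\<Inter>q. (\<lambda>z. (fst z q, snd z q)) -` {z. m (fst z) (snd z) \<le> a / c powr \<bar>of_rat q\<bar>})"
    using assms(2) by (auto simp: rational_sup_le_iff[OF assms] le_divide_eq mult.commute)
  have "continuous_on UNIV (\<lambda>z :: (rat \<Rightarrow> 'a) \<times> (rat \<Rightarrow> 'a). (fst z q, snd z q))" for q
    by (intro continuous_intros continuous_on_product_then_coordinatewise)
  then show ?thesis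
    unfolding eq using assms(1)
    by (intro closed_INT ballI closed_vimage) (auto simp: lsc_unit_def)
qed

text \<open>Every bound valid at rational times extends to a real time \<open>t\<close>: along the
  rational approximations both paths converge, and closed sublevel sets of \<open>m\<close> keep the
  bound. The cost itself need not be continuous in time.\<close>

lemma discounted_sup_eq_rational_sup:
  assumes m: "lsc_unit m" "0 < c" "c < 1" and \<omega>: "\<omega> \<in> trajectories" "\<omega>' \<in> trajectories"
  shows "discounted_sup c m \<omega> \<omega>' = rational_sup c m (rational_path \<omega>, rational_path \<omega>')"
proof (rule antisym)
  let ?a = "rational_sup c m (rational_path \<omega>, rational_path \<omega>')"
  show "discounted_sup c m \<omega> \<omega>' \<le> ?a"
    unfolding discounted_sup_le_iff[OF m]
  proof (intro allI impI)
    fix t :: real assume t: "0 \<le> t"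
    define u where "u n = (of_rat (floor_rat n t) :: real)" for n
    have u: "u \<longlonglongrightarrow> t" "\<And>n. 0 \<le> u n" "\<And>n. u n \<le> t"
      using floor_rat[OF t] unfolding u_def by auto
    have a: "c powr u n * m (\<omega> (u n)) (\<omega>' (u n)) \<le> ?a" for n
      using rational_sup_le_iff[OF m, of "(rational_path \<omega>, rational_path \<omega>')" ?a] u(2)[of n]
      by (auto simp: rational_path_def u_def dest!: spec[of _ "floor_rat n t"])
    \<comment> \<open>Since \<open>c < 1\<close>, an earlier time has the larger discount factor.
      Approximation from below therefore replaces the varying factor by the fixed
      \<open>c powr t\<close>, leaving one sublevel set for all \<open>n\<close>.\<close>
    have a': "m (\<omega> (u n)) (\<omega>' (u n)) \<le> ?a / c powr t" for n
    proof -
      have "c powr t \<le> c powr u n" using u m by (intro powr_mono') auto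
      then have "c powr t * m (\<omega> (u n)) (\<omega>' (u n)) \<le> c powr u n * m (\<omega> (u n)) (\<omega>' (u n))"
        using m(1) by (intro mult_right_mono) (auto simp: lsc_unit_def)
      then show ?thesis using a[of n] m(2) by (simp add: le_divide_eq mult.commute)
    qed
    have lim: "(\<lambda>n. \<psi> (u n)) \<longlonglongrightarrow> \<psi> t" if "\<psi> \<in> trajectories" for \<psi> :: "real \<Rightarrow> 'a"
      using that t u unfolding trajectories_def
      by (intro continuous_on_tendsto_compose[of "{0..}" \<psi>]) auto
    have "(\<omega> t, \<omega>' t) \<in> {z. m (fst z) (snd z) \<le> ?a / c powr t}"
    proof (rule Lim_in_closed_set)
      show "closed {z. m (fst z) (snd z) \<le> ?a / c powr t}" using m(1) by (auto simp: lsc_unit_def)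
      show "(\<lambda>n. (\<omega> (u n), \<omega>' (u n))) \<longlonglongrightarrow> (\<omega> t, \<omega>' t)"
        by (intro tendsto_Pair lim \<omega>)
    qed (use a' in auto)
    then show "c powr t * m (\<omega> t) (\<omega>' t) \<le> ?a" using m(2) by (simp add: le_divide_eq mult.commute)
  qed
  show "?a \<le> discounted_sup c m \<omega> \<omega>'"
    unfolding rational_sup_le_iff[OF m]
    using discounted_sup_le_iff[OF m, of \<omega> \<omega>' "discounted_sup c m \<omega> \<omega>'"]
    by (auto simp: rational_path_def)
qed

lemma lsc_unit_SUP:
  fixes d :: "nat \<Rightarrow> 'a::topological_space \<Rightarrow> 'a \<Rightarrow> real"
  assumes "\<And>n. lsc_unit (d n)"
  shows "lsc_unit (\<lambda>x y. SUP n. d n x y)" and "(SUP n. d n x y) \<le> a \<longleftrightarrow> (\<forall>n. d n x y \<le> a)"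
proof -
  have bdd: "bdd_above (range (\<lambda>n. d n x y))" for x y
    using assms by (intro bdd_aboveI[of _ 1]) (auto simp: lsc_unit_def)
  have iff: "(SUP n. d n x y) \<le> a \<longleftrightarrow> (\<forall>n. d n x y \<le> a)" for x y a
    using bdd by (subst cSUP_le_iff) auto
  then show "(SUP n. d n x y) \<le> a \<longleftrightarrow> (\<forall>n. d n x y \<le> a)" .
  have "0 \<le> (SUP n. d n x y)" for x y
  proof -
    have "0 \<le> d 0 x y" using assms by (auto simp: lsc_unit_def)
    also have "\<dots> \<le> (SUP n. d n x y)" using bdd by (intro cSUP_upper) auto
    finally show ?thesis .
  qed
  moreover have "{z. (SUP n. d n (fst z) (snd z)) \<le> a} = (\<Inter>n. {z. d n (fst z) (snd z) \<le> a})" for a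
    by (auto simp: iff)
  ultimately show "lsc_unit (\<lambda>x y. SUP n. d n x y)"
    using assms by (auto simp: lsc_unit_def iff)
qed

text \<open>A supremum over uncountably many times is not obviously measurable. On trajectories it
  coincides with \<open>rational_sup\<close>, which is Borel on the product of path spaces because
  its sublevel sets are closed.\<close>

lemma discounted_sup_measurable:
  fixes m :: "'a::polish_space \<Rightarrow> 'a \<Rightarrow> real"
  assumes "lsc_unit m" "0 < c" "c < 1"
  shows "(\<lambda>z. discounted_sup c m (fst z) (snd z)) \<in>
    borel_measurable (trajectory_space \<Otimes>\<^sub>M trajectory_space)"
proof -
  have [measurable]: "rational_sup c m \<in> borel_measurable (borel \<Otimes>\<^sub>M borel)"
    unfolding borel_prod using rational_sup_closed[OF assms] by (intro borel_measurableI_le) auto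
  have "(\<lambda>z. rational_sup c m (rational_path (fst z), rational_path (snd z))) \<in>
      borel_measurable (trajectory_space \<Otimes>\<^sub>M trajectory_space)"
    by measurable
  then show ?thesis
    by (subst measurable_cong[where g = "\<lambda>z. rational_sup c m (rational_path (fst z), rational_path (snd z))"])
      (auto simp: space_pair_measure space_trajectory_space discounted_sup_eq_rational_sup[OF assms])
qed

section \<open>The functional\<close>

text \<open>Ensures that the infimum in \<open>transport_cost\<close> ranges over a nonempty
  set.\<close>

lemma pair_measure_coupling:
  assumes "prob_space \<mu>" "prob_space \<nu>"
  shows "\<mu> \<Otimes>\<^sub>M \<nu> \<in> couplings \<mu> \<nu>"
proof -
  interpret \<mu>: prob_space \<mu> by fact
  interpret \<nu>: prob_space \<nu> by fact
  have "distr (\<mu> \<Otimes>\<^sub>M \<nu>) \<nu> snd = \<nu>"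
  proof (rule measure_eqI)
    fix B assume "B \<in> sets (distr (\<mu> \<Otimes>\<^sub>M \<nu>) \<nu> snd)"
    then have B: "B \<in> sets \<nu>" by simp
    have "snd -` B \<inter> space (\<mu> \<Otimes>\<^sub>M \<nu>) = space \<mu> \<times> B"
      using sets.sets_into_space[OF B] by (auto simp: space_pair_measure)
    then show "emeasure (distr (\<mu> \<Otimes>\<^sub>M \<nu>) \<nu> snd) B = emeasure \<nu> B"
      using B by (simp add: emeasure_distr \<nu>.emeasure_pair_measure_Times \<mu>.emeasure_space_1)
  qed simp
  then show ?thesis
    unfolding couplings_def using \<nu>.distr_pair_fst[of \<mu>] by simp
qed

lemma couplings_distr:
  assumes \<gamma>: "\<gamma> \<in> couplings \<mu> \<nu>" and f[measurable]: "f \<in> measurable \<mu> M" and g[measurable]: "g \<in> measurable \<nu> N"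
  shows "distr \<gamma> (M \<Otimes>\<^sub>M N) (\<lambda>z. (f (fst z), g (snd z))) \<in> couplings (distr \<mu> M f) (distr \<nu> N g)"
proof -
  have s[measurable_cong]: "sets \<gamma> = sets (\<mu> \<Otimes>\<^sub>M \<nu>)" and d: "distr \<gamma> \<mu> fst = \<mu>" "distr \<gamma> \<nu> snd = \<nu>"
    using \<gamma> by (auto simp: couplings_def)
  let ?h = "\<lambda>z. (f (fst z), g (snd z))"
  have "distr (distr \<gamma> (M \<Otimes>\<^sub>M N) ?h) (distr \<mu> M f) fst = distr (distr \<gamma> (M \<Otimes>\<^sub>M N) ?h) M fst"
    by (rule distr_cong) auto
  also have "\<dots> = distr \<gamma> M (\<lambda>z. f (fst z))"
    by (subst distr_distr) (auto simp: comp_def)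
  also have "\<dots> = distr (distr \<gamma> \<mu> fst) M f"
    by (subst distr_distr) (auto simp: comp_def)
  finally have 1: "distr (distr \<gamma> (M \<Otimes>\<^sub>M N) ?h) (distr \<mu> M f) fst = distr \<mu> M f" unfolding d .
  have "distr (distr \<gamma> (M \<Otimes>\<^sub>M N) ?h) (distr \<nu> N g) snd = distr (distr \<gamma> (M \<Otimes>\<^sub>M N) ?h) N snd"
    by (rule distr_cong) auto
  also have "\<dots> = distr \<gamma> N (\<lambda>z. g (snd z))"
    by (subst distr_distr) (auto simp: comp_def)
  also have "\<dots> = distr (distr \<gamma> \<nu> snd) N g"
    by (subst distr_distr) (auto simp: comp_def)
  finally have 2: "distr (distr \<gamma> (M \<Otimes>\<^sub>M N) ?h) (distr \<nu> N g) snd = distr \<nu> N g" unfolding d .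
  show ?thesis using 1 2 by (simp add: couplings_def)
qed

lemma couplings_AE:
  assumes \<gamma>: "\<gamma> \<in> couplings \<mu> \<nu>"
  shows "AE x in \<mu>. P x \<Longrightarrow> AE z in \<gamma>. P (fst z)" "AE y in \<nu>. Q y \<Longrightarrow> AE z in \<gamma>. Q (snd z)"
proof -
  have s[measurable_cong]: "sets \<gamma> = sets (\<mu> \<Otimes>\<^sub>M \<nu>)" and d: "distr \<gamma> \<mu> fst = \<mu>" "distr \<gamma> \<nu> snd = \<nu>"
    using \<gamma> by (auto simp: couplings_def)
  have m: "fst \<in> measurable \<gamma> \<mu>" "snd \<in> measurable \<gamma> \<nu>" by measurable
  show "AE z in \<gamma>. P (fst z)" if "AE x in \<mu>. P x"
    by (rule AE_distrD[OF m(1)]) (unfold d, rule that)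
  show "AE z in \<gamma>. Q (snd z)" if "AE y in \<nu>. Q y"
    by (rule AE_distrD[OF m(2)]) (unfold d, rule that)
qed

context diffusion
begin

section \<open>Laws of the diffusion at rational times and limits of their couplings\<close>

lemma law_prob_space: "prob_space (\<P> x)" and sets_law: "sets (\<P> x) = sets trajectory_space"
  using law[of x] by (auto simp: space_prob_algebra)

text \<open>The finite-dimensional distribution for an empty list of later times, with
  \<open>{x}\<close> as the set prescribed at time 0.\<close>

lemma law_start: "AE \<omega> in \<P> x. \<omega> 0 = x"
proof -
  interpret prob_space "\<P> x" by (rule law_prob_space)
  have sp: "space (\<P> x) = trajectories"
    using sets_eq_imp_space_eq[OF sets_law] by (simp add: space_trajectory_space)
  have "emeasure (\<P> x) {\<omega> \<in> trajectories. \<omega> 0 \<in> {x} \<and> (\<forall>(t, B) \<in> set []. \<omega> t \<in> B)} = 1"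
    by (subst finite_dim_distributions) auto
  then have "prob {\<omega> \<in> trajectories. \<omega> 0 = x} = 1" by (simp add: emeasure_eq_measure)
  then have "AE \<omega> in \<P> x. \<omega> \<in> {\<omega> \<in> trajectories. \<omega> 0 = x}" by (rule AE_prob_1)
  then show ?thesis by simp
qed

lemma eval_uniform_continuous:
  assumes "0 \<le> t"
  shows "continuous_map (uniform_topology \<Delta>) euclidean (\<lambda>\<omega>. \<omega> t)"
proof -
  interpret U: Metric_space trajectories "uniform_dist \<Delta>"
    by (rule Metric_space_uniform_dist[OF metric metric_bounded])
  have "\<Delta> (\<omega> t) (\<omega>' t) \<le> uniform_dist \<Delta> \<omega> \<omega>'" for \<omega> \<omega>'
    unfolding uniform_dist_def using assms metric_bounded
    by (intro cSUP_upper bdd_aboveI[of _ 1]) auto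
  then show ?thesis
    unfolding uniform_topology_def metric_topology[symmetric] U.metric_continuous_map[OF metric]
    by (meson UNIV_I image_subsetI order.strict_trans1)
qed

text \<open>Each evaluation is 1-Lipschitz from the uniform metric to \<open>\<Delta>\<close>. This
  is the passage from the uniform topology to the separable product topology.\<close>

lemma rational_path_uniform_continuous:
  "continuous_map (uniform_topology \<Delta>) euclidean rational_path"
proof -
  have "continuous_map (uniform_topology \<Delta>) (product_topology (\<lambda>q::rat. euclidean) UNIV) rational_path"
    unfolding continuous_map_componentwise_UNIV
    using eval_uniform_continuous by (simp add: rational_path_def)
  then show ?thesis by (simp add: euclidean_product_topology)
qed

definition rational_law :: "'a \<Rightarrow> (rat \<Rightarrow> 'a) measure" where
  "rational_law x = distr (\<P> x) borel rational_path"

lemma law_measurable_rational_path [measurable]: "rational_path \<in> borel_measurable (\<P> x)"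
  using rational_path_measurable sets_law by (simp cong: measurable_cong_sets)

lemma rational_law: "prob_space (rational_law x)" "sets (rational_law x) = sets borel"
  unfolding rational_law_def by (auto intro!: prob_space.prob_space_distr law_prob_space)

text \<open>A bounded continuous test function on rational paths pulls back to one on trajectories
  that is both uniformly continuous in the topological sense of \<open>continuous_map\<close> and
  measurable for the evaluations, so the weak continuity of \<open>\<P>\<close> applies to
  it.\<close>

lemma rational_law_weakly_continuous:
  fixes f :: "(rat \<Rightarrow> 'a) \<Rightarrow> real"
  assumes f: "continuous_on UNIV f" "bounded (range f)"
  shows "continuous_on UNIV (\<lambda>x. \<integral>p. f p \<partial>rational_law x)"
proof -
  have [measurable]: "f \<in> borel_measurable borel" using f by (intro borel_measurable_continuous_onI)
  have "continuous_map (uniform_topology \<Delta>) euclidean (f \<circ> rational_path)"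
    using rational_path_uniform_continuous f(1) by (intro continuous_map_compose) auto
  moreover have "bounded ((f \<circ> rational_path) ` trajectories)"
    using f(2) by (rule bounded_subset) auto
  moreover have "f \<circ> rational_path \<in> borel_measurable trajectory_space"
    by measurable
  ultimately have "continuous_on UNIV (\<lambda>x. \<integral>\<omega>. (f \<circ> rational_path) \<omega> \<partial>\<P> x)"
    by (rule weakly_continuous)
  then show ?thesis by (simp add: rational_law_def integral_distr)
qed

lemma integral_discounted_sup:
  assumes m: "lsc_unit m" "0 < c" "c < 1" and \<gamma>: "\<gamma> \<in> couplings (\<P> x) (\<P> y)"
  shows "integrable \<gamma> (\<lambda>z. discounted_sup c m (fst z) (snd z))"
    and "(\<integral>z. discounted_sup c m (fst z) (snd z) \<partial>\<gamma>) =
     (\<integral>z. rational_sup c m z \<partial>distr \<gamma> (borel \<Otimes>\<^sub>M borel) (\<lambda>z. (rational_path (fst z), rational_path (snd z))))"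
proof -
  interpret \<gamma>: prob_space \<gamma> using couplings_prob_space[OF \<gamma> law_prob_space] .
  have s[measurable_cong]: "sets \<gamma> = sets (trajectory_space \<Otimes>\<^sub>M trajectory_space)"
    using \<gamma> sets_law by (auto simp: couplings_def cong: sets_pair_measure_cong)
  have sp: "space \<gamma> = trajectories \<times> trajectories"
    using sets_eq_imp_space_eq[OF s] by (simp add: space_pair_measure space_trajectory_space)
  have "(\<lambda>z. discounted_sup c m (fst z) (snd z)) \<in> borel_measurable \<gamma>"
    using discounted_sup_measurable[OF m] s by (simp cong: measurable_cong_sets)
  then show "integrable \<gamma> (\<lambda>z. discounted_sup c m (fst z) (snd z))"
    using discounted_sup_bounds[OF m] by (intro \<gamma>.integrable_const_bound[where B=1]) auto
  have "rational_sup c m \<in> borel_measurable (borel \<Otimes>\<^sub>M borel)"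
    unfolding borel_prod using rational_sup_closed[OF m] by (intro borel_measurableI_le) auto
  then show "(\<integral>z. discounted_sup c m (fst z) (snd z) \<partial>\<gamma>) =
     (\<integral>z. rational_sup c m z \<partial>distr \<gamma> (borel \<Otimes>\<^sub>M borel) (\<lambda>z. (rational_path (fst z), rational_path (snd z))))"
    by (subst integral_distr)
      (auto intro!: Bochner_Integration.integral_cong simp: sp discounted_sup_eq_rational_sup[OF m])
qed

text \<open>The measurable inverse \<open>s\<close> is applied to both coordinates. The round trip
  through trajectories returns \<gamma> because both marginals are carried by extendable paths,
  where it is the identity.\<close>

lemma coupling_of_rational_coupling:
  assumes \<gamma>: "\<gamma> \<in> couplings (rational_law x) (rational_law y)"
  shows "\<exists>\<gamma>' \<in> couplings (\<P> x) (\<P> y).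
    distr \<gamma>' (borel \<Otimes>\<^sub>M borel) (\<lambda>z. (rational_path (fst z), rational_path (snd z))) = \<gamma>"
proof -
  obtain s where s[measurable]: "s \<in> measurable borel (trajectory_space :: (real \<Rightarrow> 'a) measure)"
    and s1: "\<And>\<omega>. \<omega> \<in> trajectories \<Longrightarrow> s (rational_path \<omega>) = \<omega>"
    and s2: "\<And>f. f \<in> extendable_paths \<Longrightarrow> rational_path (s f) = f"
    using rational_path_inverse by blast
  have pull: "distr (rational_law x) trajectory_space s = \<P> x" for x
  proof -
    have sp: "space (\<P> x) = trajectories"
      using sets_eq_imp_space_eq[OF sets_law] by (simp add: space_trajectory_space)
    have "distr (rational_law x) trajectory_space s = distr (\<P> x) trajectory_space (\<lambda>\<omega>. s (rational_path \<omega>))"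
      unfolding rational_law_def by (subst distr_distr) (auto simp: comp_def)
    also have "\<dots> = distr (\<P> x) (\<P> x) (\<lambda>\<omega>. \<omega>)"
      using sets_law by (intro distr_cong) (auto simp: sp s1)
    finally show ?thesis by (simp add: distr_id2)
  qed
  have sg[measurable_cong]: "sets \<gamma> = sets (borel \<Otimes>\<^sub>M borel)"
    using \<gamma> rational_law(2) by (auto simp: couplings_def cong: sets_pair_measure_cong)
  have [measurable]: "s \<in> measurable (rational_law x) trajectory_space" for x
    using s rational_law(2) by (simp cong: measurable_cong_sets)
  define \<gamma>' where "\<gamma>' = distr \<gamma> (trajectory_space \<Otimes>\<^sub>M trajectory_space) (\<lambda>z. (s (fst z), s (snd z)))"
  have "\<gamma>' \<in> couplings (\<P> x) (\<P> y)"
    using couplings_distr[OF \<gamma>, of s trajectory_space s trajectory_space] unfolding \<gamma>'_def pull by simp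
  moreover have "distr \<gamma>' (borel \<Otimes>\<^sub>M borel) (\<lambda>z. (rational_path (fst z), rational_path (snd z))) = \<gamma>"
  proof -
    have ext: "AE f in rational_law x. f \<in> extendable_paths" for x
      unfolding rational_law_def using extendable_paths_borel sets_eq_imp_space_eq[OF sets_law, of x]
      by (subst AE_distr_iff) (auto simp: rational_path_extendable space_trajectory_space)
    have "AE z in \<gamma>. (rational_path (s (fst z)), rational_path (s (snd z))) = z"
      using couplings_AE(1)[OF \<gamma> ext] couplings_AE(2)[OF \<gamma> ext]
      by eventually_elim (simp add: s2)
    then have "distr \<gamma> (borel \<Otimes>\<^sub>M borel) (\<lambda>z. (rational_path (s (fst z)), rational_path (s (snd z)))) =
        distr \<gamma> (borel \<Otimes>\<^sub>M borel) (\<lambda>z. z)"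
      by (intro distr_cong_AE) auto
    also have "\<dots> = \<gamma>" using sg by (simp add: distr_id2)
    finally show ?thesis
      unfolding \<gamma>'_def by (subst distr_distr) (auto simp: comp_def)
  qed
  ultimately show ?thesis by blast
qed

text \<open>Push the couplings to rational paths, take a cluster coupling there, and pull it back.
  One coupling serves all costs and all bounds simultaneously, which is what the increasing sequence
  of iterates calls for. The bound need hold only eventually, as the cluster filter refines the
  sequential one.\<close>

lemma limit_coupling:
  assumes c: "0 < c" "c < 1" and lim: "xs \<longlonglongrightarrow> x" "ys \<longlonglongrightarrow> y"
    and \<gamma>: "\<And>i :: nat. \<gamma> i \<in> couplings (\<P> (xs i)) (\<P> (ys i))"
  shows "\<exists>\<gamma>0 \<in> couplings (\<P> x) (\<P> y). \<forall>m b. lsc_unit m \<longrightarrow>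
    (\<forall>\<^sub>F i in sequentially. (\<integral>z. discounted_sup c m (fst z) (snd z) \<partial>\<gamma> i) \<le> b) \<longrightarrow>
    (\<integral>z. discounted_sup c m (fst z) (snd z) \<partial>\<gamma>0) \<le> b"
proof -
  define \<eta> where "\<eta> i = distr (\<gamma> i) (borel \<Otimes>\<^sub>M borel) (\<lambda>z. (rational_path (fst z), rational_path (snd z)))" for i
  have \<eta>: "\<eta> i \<in> couplings (rational_law (xs i)) (rational_law (ys i))" for i
    unfolding \<eta>_def rational_law_def by (rule couplings_distr[OF \<gamma>]) auto
  have weak: "(\<lambda>i. \<integral>p. f p \<partial>rational_law (us i)) \<longlonglongrightarrow> (\<integral>p. f p \<partial>rational_law u)"
    if "us \<longlonglongrightarrow> u" "continuous_on UNIV f" "bounded (range f)" for us u and f :: "(rat \<Rightarrow> 'a) \<Rightarrow> real"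
    using continuous_on_tendsto_compose[OF rational_law_weakly_continuous[OF that(2,3)] that(1)] by simp
  obtain F \<eta>0 where F: "F \<le> sequentially" "F \<noteq> bot" and \<eta>0: "\<eta>0 \<in> couplings (rational_law x) (rational_law y)"
    and op: "\<And>U. open U \<Longrightarrow> \<exists>l. ((\<lambda>i. measure (\<eta> i) U) \<longlongrightarrow> l) F \<and> measure \<eta>0 U \<le> l"
    using coupling_cluster[where \<gamma> = \<eta>, OF sequentially_bot rational_law rational_law rational_law rational_law
        weak[OF lim(1)] weak[OF lim(2)] \<eta>] by blast
  obtain \<gamma>0 where \<gamma>0: "\<gamma>0 \<in> couplings (\<P> x) (\<P> y)"
    "distr \<gamma>0 (borel \<Otimes>\<^sub>M borel) (\<lambda>z. (rational_path (fst z), rational_path (snd z))) = \<eta>0"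
    using coupling_of_rational_coupling[OF \<eta>0] by blast
  have borel: "sets \<eta>' = sets borel" if "\<eta>' \<in> couplings (rational_law u) (rational_law v)" for \<eta>' u v
    using that rational_law(2) unfolding borel_prod[symmetric]
    by (auto simp: couplings_def cong: sets_pair_measure_cong)
  have "(\<integral>z. discounted_sup c m (fst z) (snd z) \<partial>\<gamma>0) \<le> b"
    if m: "lsc_unit m" and b: "\<forall>\<^sub>F i in sequentially. (\<integral>z. discounted_sup c m (fst z) (snd z) \<partial>\<gamma> i) \<le> b" for m b
  proof -
    have "(\<integral>z. rational_sup c m z \<partial>\<eta>0) \<le> b"
    proof (rule integral_le_cluster[OF F(2), where \<gamma> = \<eta>])
      show "\<forall>\<^sub>F i in F. (\<integral>z. rational_sup c m z \<partial>\<eta> i) \<le> b"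
        using filter_leD[OF F(1) b] integral_discounted_sup(2)[OF m c \<gamma>] by (simp add: \<eta>_def)
    qed (use rational_sup_bounds[OF m c] rational_sup_closed[OF m c] op borel[OF \<eta>] borel[OF \<eta>0]
        couplings_prob_space[OF \<eta> rational_law(1)] couplings_prob_space[OF \<eta>0 rational_law(1)] in auto)
    then show ?thesis using integral_discounted_sup(2)[OF m c \<gamma>0(1)] \<gamma>0(2) by simp
  qed
  then show ?thesis using \<gamma>0(1) by blast
qed

section \<open>Bounds and lower semicontinuity of the functional, and the fixpoint\<close>

lemma discounted_cost_nonneg:
  assumes "lsc_unit m" "0 < c" "c < 1"
  shows "0 \<le> (\<integral>z. discounted_sup c m (fst z) (snd z) \<partial>\<gamma>)"
  using discounted_sup_bounds[OF assms] by (intro Bochner_Integration.integral_nonneg) auto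

lemma \<G>_le:
  assumes "lsc_unit m" "0 < c" "c < 1" "\<gamma> \<in> couplings (\<P> x) (\<P> y)"
  shows "\<G> \<P> c m x y \<le> (\<integral>z. discounted_sup c m (fst z) (snd z) \<partial>\<gamma>)"
  unfolding \<G>_def transport_cost_def using assms discounted_cost_nonneg[OF assms(1-3)]
  by (intro cINF_lower bdd_belowI[of _ 0]) auto

lemma \<G>_greatest:
  assumes "\<And>\<gamma>. \<gamma> \<in> couplings (\<P> x) (\<P> y) \<Longrightarrow> a \<le> (\<integral>z. discounted_sup c m (fst z) (snd z) \<partial>\<gamma>)"
  shows "a \<le> \<G> \<P> c m x y"
  unfolding \<G>_def transport_cost_def
  using assms pair_measure_coupling[OF law_prob_space law_prob_space]
  by (intro cINF_greatest) auto

lemma \<G>_approx: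
  assumes "\<G> \<P> c m x y < a"
  shows "\<exists>\<gamma> \<in> couplings (\<P> x) (\<P> y). (\<integral>z. discounted_sup c m (fst z) (snd z) \<partial>\<gamma>) \<le> a"
proof (rule ccontr)
  assume "\<not> ?thesis"
  then have "a \<le> \<G> \<P> c m x y" by (intro \<G>_greatest) auto
  then show False using assms by simp
qed

lemma \<G>_mem_unit:
  assumes m: "lsc_unit m" "0 < c" "c < 1"
  shows "\<G> \<P> c m x y \<in> {0..1}"
proof -
  define \<gamma> where "\<gamma> = \<P> x \<Otimes>\<^sub>M \<P> y"
  have \<gamma>: "\<gamma> \<in> couplings (\<P> x) (\<P> y)"
    unfolding \<gamma>_def by (intro pair_measure_coupling law_prob_space)
  interpret prob_space \<gamma> using couplings_prob_space[OF \<gamma> law_prob_space] .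
  have "(\<integral>z. discounted_sup c m (fst z) (snd z) \<partial>\<gamma>) \<le> (\<integral>z. 1 \<partial>\<gamma>)"
    using integral_discounted_sup(1)[OF m \<gamma>] discounted_sup_bounds[OF m] by (intro integral_mono) auto
  then have "\<G> \<P> c m x y \<le> 1"
    using \<G>_le[OF m \<gamma>] by (simp add: prob_space)
  then show ?thesis
    using \<G>_greatest[of x y 0 c m] discounted_cost_nonneg[OF m] by auto
qed

text \<open>Under any coupling the two trajectories almost surely start at \<open>x\<close> and
  \<open>y\<close>, so the time 0 term of the supremum, whose discount factor is 1, already equals
  \<open>m x y\<close>.\<close>

lemma \<G>_ge:
  assumes m: "lsc_unit m" "0 < c" "c < 1"
  shows "m x y \<le> \<G> \<P> c m x y"
proof (rule \<G>_greatest)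
  fix \<gamma> assume \<gamma>: "\<gamma> \<in> couplings (\<P> x) (\<P> y)"
  interpret prob_space \<gamma> using couplings_prob_space[OF \<gamma> law_prob_space] .
  have "AE z in \<gamma>. m x y \<le> discounted_sup c m (fst z) (snd z)"
    using couplings_AE(1)[OF \<gamma> law_start] couplings_AE(2)[OF \<gamma> law_start]
  proof eventually_elim
    case (elim z)
    have "c powr 0 * m (fst z 0) (snd z 0) \<le> discounted_sup c m (fst z) (snd z)"
      using discounted_sup_le_iff[OF m] by (metis order_refl)
    then show ?case using elim m(2) by simp
  qed
  then have "(\<integral>z. m x y \<partial>\<gamma>) \<le> (\<integral>z. discounted_sup c m (fst z) (snd z) \<partial>\<gamma>)"
    using integral_discounted_sup(1)[OF m \<gamma>] by (intro integral_mono_AE) auto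
  then show "m x y \<le> (\<integral>z. discounted_sup c m (fst z) (snd z) \<partial>\<gamma>)" by (simp add: prob_space)
qed

text \<open>Nearly optimal couplings along a convergent sequence of pairs of starting points have a
  limit coupling whose cost obeys the same bound.\<close>

lemma \<G>_lsc_unit:
  assumes m: "lsc_unit m" "0 < c" "c < 1"
  shows "lsc_unit (\<G> \<P> c m)"
  unfolding lsc_unit_def
proof (intro conjI allI)
  show "\<G> \<P> c m x y \<in> {0..1}" for x y by (rule \<G>_mem_unit[OF m])
  show "closed {z. \<G> \<P> c m (fst z) (snd z) \<le> a}" for a
    unfolding closed_sequential_limits
  proof (intro allI impI, elim conjE)
    fix zs z assume zs: "\<forall>n. zs n \<in> {z. \<G> \<P> c m (fst z) (snd z) \<le> a}" and lim: "zs \<longlonglongrightarrow> z"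
    \<comment> \<open>The slack stands in for optimal couplings, so attainment of the infimum is not
      called upon.\<close>
    have "\<G> \<P> c m (fst z) (snd z) \<le> a + \<epsilon>" if "0 < \<epsilon>" for \<epsilon>
    proof -
      have "\<G> \<P> c m (fst (zs i)) (snd (zs i)) < a + \<epsilon>" for i
        using zs \<open>0 < \<epsilon>\<close> by (auto intro: order.strict_trans1[of _ a])
      then have "\<exists>\<gamma> \<in> couplings (\<P> (fst (zs i))) (\<P> (snd (zs i))). (\<integral>z. discounted_sup c m (fst z) (snd z) \<partial>\<gamma>) \<le> a + \<epsilon>" for i
        by (rule \<G>_approx)
      then obtain \<gamma> where \<gamma>: "\<And>i. \<gamma> i \<in> couplings (\<P> (fst (zs i))) (\<P> (snd (zs i)))"
        "\<And>i. (\<integral>z. discounted_sup c m (fst z) (snd z) \<partial>\<gamma> i) \<le> a + \<epsilon>"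
        by metis
      obtain \<gamma>0 where "\<gamma>0 \<in> couplings (\<P> (fst z)) (\<P> (snd z))"
        "(\<integral>z. discounted_sup c m (fst z) (snd z) \<partial>\<gamma>0) \<le> a + \<epsilon>"
        using limit_coupling[OF m(2,3) tendsto_fst[OF lim] tendsto_snd[OF lim] \<gamma>(1)] m(1) \<gamma>(2)
        by (auto intro: always_eventually)
      then show ?thesis using \<G>_le[OF m] order_trans by blast
    qed
    then show "z \<in> {z. \<G> \<P> c m (fst z) (snd z) \<le> a}"
      by (auto intro: field_le_epsilon)
  qed
qed

lemma limit_dist_fixpoint:
  assumes obs: "continuous_on UNIV obs" "\<And>x. obs x \<in> {0..1}" and c: "0 < c" "c < 1"
  shows "\<G> \<P> c (limit_dist \<P> obs c) x y = limit_dist \<P> obs c x y"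
proof -
  define d where "d = iterated_dist \<P> obs c"
  define e where "e = limit_dist \<P> obs c"
  have d: "lsc_unit (d n)" for n
  proof (induction n)
    case 0
    \<comment> \<open>Continuity of \<open>obs\<close> enters here; later iterates inherit lower
      semicontinuity from \<open>\<G>_lsc_unit\<close>.\<close>
    have "closed {z. \<bar>obs (fst z) - obs (snd z)\<bar> \<le> a}" for a
      by (intro closed_Collect_le continuous_intros continuous_on_compose2[OF obs(1)]) auto
    moreover have "\<bar>obs u - obs v\<bar> \<le> 1" for u v
      using obs(2)[of u] obs(2)[of v] by auto
    ultimately show ?case by (simp add: d_def lsc_unit_def)
  next
    case (Suc n)
    then show ?case using \<G>_lsc_unit[OF _ c] by (simp add: d_def)
  qed
  have d_mono: "d n u v \<le> d k u v" if "n \<le> k" for n k u v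
  proof (rule lift_Suc_mono_le[OF _ that])
    show "d n u v \<le> d (Suc n) u v" for n
      using \<G>_ge[OF d c, of n u v] by (simp add: d_def)
  qed
  have e: "e = (\<lambda>u v. SUP n. d n u v)"
    by (simp add: e_def d_def limit_dist_def fun_eq_iff)
  note e_lsc = lsc_unit_SUP(1)[of d, OF d, folded e]
  have e_le: "e u v \<le> a \<longleftrightarrow> (\<forall>n. d n u v \<le> a)" for u v a
    using lsc_unit_SUP(2)[of d, OF d] by (simp add: e)
  have U_mono: "discounted_sup c (d n) \<omega> \<omega>' \<le> discounted_sup c (d k) \<omega> \<omega>'" if "n \<le> k" for n k \<omega> \<omega>'
    unfolding discounted_sup_le_iff[OF d c]
  proof (intro allI impI)
    fix t :: real assume "0 \<le> t"
    then have "c powr t * d k (\<omega> t) (\<omega>' t) \<le> discounted_sup c (d k) \<omega> \<omega>'"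
      using discounted_sup_le_iff[OF d c] by blast
    moreover have "c powr t * d n (\<omega> t) (\<omega>' t) \<le> c powr t * d k (\<omega> t) (\<omega>' t)"
      using d_mono[OF that] by (intro mult_left_mono) auto
    ultimately show "c powr t * d n (\<omega> t) (\<omega>' t) \<le> discounted_sup c (d k) \<omega> \<omega>'" by simp
  qed
  \<comment> \<open>The suprema over \<open>n\<close> and over \<open>t\<close> commute. Moving the
    positive factor \<open>c powr t\<close> to the other side leaves a bound on \<open>e\<close>
    itself, which splits into bounds on the iterates.\<close>
  have U_e_le: "discounted_sup c e \<omega> \<omega>' \<le> a \<longleftrightarrow> (\<forall>n. discounted_sup c (d n) \<omega> \<omega>' \<le> a)" for \<omega> \<omega>' a
  proof -
    have "discounted_sup c e \<omega> \<omega>' \<le> a \<longleftrightarrow> (\<forall>t\<ge>0. e (\<omega> t) (\<omega>' t) \<le> a / c powr t)"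
      using c by (simp add: discounted_sup_le_iff[OF e_lsc c] le_divide_eq mult.commute)
    also have "\<dots> \<longleftrightarrow> (\<forall>n. \<forall>t\<ge>0. d n (\<omega> t) (\<omega>' t) \<le> a / c powr t)"
      unfolding e_le by auto
    also have "\<dots> \<longleftrightarrow> (\<forall>n. discounted_sup c (d n) \<omega> \<omega>' \<le> a)"
      using c by (simp add: discounted_sup_le_iff[OF d c] le_divide_eq mult.commute)
    finally show ?thesis .
  qed
  have U_lim: "(\<lambda>n. discounted_sup c (d n) \<omega> \<omega>') \<longlonglongrightarrow> discounted_sup c e \<omega> \<omega>'" for \<omega> \<omega>'
  proof (rule increasing_tendsto)
    show "\<forall>\<^sub>F n in sequentially. discounted_sup c (d n) \<omega> \<omega>' \<le> discounted_sup c e \<omega> \<omega>'"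
      using U_e_le[of \<omega> \<omega>' "discounted_sup c e \<omega> \<omega>'"] by simp
    fix a assume "a < discounted_sup c e \<omega> \<omega>'"
    then obtain n where "a < discounted_sup c (d n) \<omega> \<omega>'"
      using U_e_le by (meson not_le)
    then show "\<forall>\<^sub>F n in sequentially. a < discounted_sup c (d n) \<omega> \<omega>'"
      using U_mono unfolding eventually_sequentially by (meson order.strict_trans2)
  qed
  have "\<exists>\<gamma> \<in> couplings (\<P> x) (\<P> y).
      (\<integral>z. discounted_sup c (d n) (fst z) (snd z) \<partial>\<gamma>) \<le> d (Suc n) x y + 1 / Suc n" for n
    by (rule \<G>_approx) (simp add: d_def)
  then obtain \<gamma> where \<gamma>: "\<And>n. \<gamma> n \<in> couplings (\<P> x) (\<P> y)"
    "\<And>n. (\<integral>z. discounted_sup c (d n) (fst z) (snd z) \<partial>\<gamma> n) \<le> d (Suc n) x y + 1 / Suc n"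
    by metis
  \<comment> \<open>The starting points stay fixed here; only the couplings vary with
    \<open>n\<close>.\<close>
  from limit_coupling[OF c tendsto_const tendsto_const \<gamma>(1)]
  obtain \<gamma>0 where \<gamma>0: "\<gamma>0 \<in> couplings (\<P> x) (\<P> y)"
    and lim: "\<forall>m b. lsc_unit m \<longrightarrow>
      (\<forall>\<^sub>F i in sequentially. (\<integral>z. discounted_sup c m (fst z) (snd z) \<partial>\<gamma> i) \<le> b) \<longrightarrow>
      (\<integral>z. discounted_sup c m (fst z) (snd z) \<partial>\<gamma>0) \<le> b"
    by (rule bexE)
  have cost: "(\<integral>z. discounted_sup c (d k) (fst z) (snd z) \<partial>\<gamma>0) \<le> e x y" for k
  proof (rule field_le_epsilon)
    fix \<epsilon> :: real assume "0 < \<epsilon>"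
    then obtain N where N: "1 / real (Suc N) < \<epsilon>"
      using reals_Archimedean by (auto simp: inverse_eq_divide)
    show "(\<integral>z. discounted_sup c (d k) (fst z) (snd z) \<partial>\<gamma>0) \<le> e x y + \<epsilon>"
    \<comment> \<open>The cost is frozen at index \<open>k\<close> while the coupling index
      \<open>n\<close> grows: for \<open>n \<ge> k\<close> the cost of \<open>d k\<close> under
      \<open>\<gamma> n\<close> is at most that of \<open>d n\<close>, for which
      \<open>\<gamma> n\<close> was chosen nearly optimal. The remaining slack is at most
      \<open>1 / Suc N\<close>.\<close>
    proof (rule lim[rule_format, OF d eventually_sequentiallyI])
      fix n assume n: "max k N \<le> n"
      have "(\<integral>z. discounted_sup c (d k) (fst z) (snd z) \<partial>\<gamma> n) \<le> (\<integral>z. discounted_sup c (d n) (fst z) (snd z) \<partial>\<gamma> n)"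
        using n U_mono by (intro integral_mono integral_discounted_sup(1)[OF d c \<gamma>(1)]) auto
      also have "\<dots> \<le> d (Suc n) x y + 1 / Suc n" by (rule \<gamma>)
      also have "\<dots> \<le> e x y + 1 / Suc N"
        using n e_le[of x y "e x y"] by (intro add_mono frac_le) auto
      finally show "(\<integral>z. discounted_sup c (d k) (fst z) (snd z) \<partial>\<gamma> n) \<le> e x y + \<epsilon>"
        using N by linarith
    qed
  qed
  have "(\<lambda>n. \<integral>z. discounted_sup c (d n) (fst z) (snd z) \<partial>\<gamma>0) \<longlonglongrightarrow>
      (\<integral>z. discounted_sup c e (fst z) (snd z) \<partial>\<gamma>0)"
  \<comment> \<open>Now \<open>k\<close> tends to infinity under the one coupling
    \<open>\<gamma>0\<close>; all costs are bounded by 1.\<close>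
  proof (rule integral_dominated_convergence[where w = "\<lambda>_. 1"])
    interpret prob_space \<gamma>0 using couplings_prob_space[OF \<gamma>0 law_prob_space] .
    show "integrable \<gamma>0 (\<lambda>_. 1 :: real)" by simp
    show "AE z in \<gamma>0. (\<lambda>n. discounted_sup c (d n) (fst z) (snd z)) \<longlonglongrightarrow> discounted_sup c e (fst z) (snd z)"
      using U_lim by simp
    show "AE z in \<gamma>0. norm (discounted_sup c (d n) (fst z) (snd z)) \<le> 1" for n
      using discounted_sup_bounds[OF d c] by simp
  qed (intro borel_measurable_integrable integral_discounted_sup(1)[OF _ c \<gamma>0] e_lsc d)+
  then have "(\<integral>z. discounted_sup c e (fst z) (snd z) \<partial>\<gamma>0) \<le> e x y"
    using cost by (intro LIMSEQ_le_const2) auto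
  then have "\<G> \<P> c e x y \<le> e x y"
    using \<G>_le[OF e_lsc c \<gamma>0] by linarith
  then show ?thesis
    using \<G>_ge[OF e_lsc c, of x y] unfolding e_def by (rule antisym)
qed

end

theorem theorem4p9:
  fixes Phat :: "real \<Rightarrow> ('a::polish_space \<Rightarrow> real) \<Rightarrow> ('a \<Rightarrow> real)"
    and P :: "real \<Rightarrow> 'a \<Rightarrow> 'a measure"
    and \<Delta> :: "'a \<Rightarrow> 'a \<Rightarrow> real"
    and \<P> :: "'a \<Rightarrow> (real \<Rightarrow> 'a) measure"
    and obs :: "'a \<Rightarrow> real"
    and c :: real
  assumes "diffusion Phat P \<Delta> \<P>"
    and "continuous_on UNIV obs"
    and "\<And>x. obs x \<in> {0..1}"
    and "0 < c" and "c < 1"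
  shows "\<forall>x y. \<G> \<P> c (limit_dist \<P> obs c) x y = limit_dist \<P> obs c x y"
  using diffusion.limit_dist_fixpoint[OF assms] by blast

end
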